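(* For any nonempty compact set $X\subseteq\mathbb R^n$ the following are equivalent: (i) $X$ has an outgoing tangent at some point $x\in X$; (ii) the Riesz space $\mathcal R(X)$ is not strongly semisimple, i.e. some principal ideal of $\mathcal R(X)$ is not an intersection of maximal ideals of $\mathcal R(X)$.
   Context: For $y\in\mathbb R^n$ and a linear subspace $L$, $\mathsf{proj}_L(y)$ is the orthogonal projection. Frenet frame of a sequence $\{x_i\}$ converging to $x$: $u_1$ is its Frenet $1$-frame if $x_i\ne x$ for all $i$ and $u_1=\lim_i (x_i-x)/\|x_i-x\|$; a $k$-tuple $(u_1,\ldots,u_k)$ of pairwise orthogonal unit vectors is its Frenet $k$-frame if $(u_1,\ldots,u_{k-1})$ is its Frenet $(k-1)$-frame and $u_k=\lim_i\frac{x_i-x-\mathsf{proj}_{\mathbb Ru_1+\cdots+\mathbb Ru_{k-1}}(x_i-x)}{\|x_i-x-\mathsf{proj}_{\mathbb Ru_1+\cdots+\mathbb Ru_{k-1}}(x_i-x)\|}$ (nonzero denominators). Tangent: for $X\subseteq\mathbb R^n$, $x\in\mathbb R^n$, a $k$-tuple $u=(u_1,\ldots,u_k)$ of pairwise orthogonal unit vectors ($k\ge1$) is a tangent of $X$ at $x$ if $X$ contains a sequence converging to $x$ whose Frenet $k$-frame is $u$. It is outgoing if moreover there are $\lambda_1,\ldots,\lambda_k>0$ such that $C=\operatorname{conv}(x,x+\lambda_1u_1,\ldots,x+\lambda_1u_1+\cdots+\lambda_ku_k)$ and $C'=\operatorname{conv}(x,x+\lambda_1u_1,\ldots,x+\lambda_1u_1+\cdots+\lambda_{k-1}u_{k-1})$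 satisfy $C\cap X=C'\cap X$. $\mathcal R(X)$: choose a closed $n$-cube $K\supseteq X$; $g\colon K\to\mathbb R$ is piecewise linear if there is a triangulation $\Delta$ of $K$ with $g$ continuous and affine linear on each simplex of $\Delta$. $\mathcal R(X)$ is the Riesz space (pointwise operations) of restrictions to $X$ of such functions (independent of $K$). The principal ideal generated by $g$ is $\{f: |f|\le m|g|\text{ for some }m\in\mathbb N\}$. A Riesz space is strongly semisimple if every principal ideal is an intersection of maximal ideals. *)

theory Defs
  imports "HOL-Analysis.Analysis"
begin

definition proj :: "'a::euclidean_space set \<Rightarrow> 'a \<Rightarrow> 'a" where
  "proj L y = (THE p. p \<in> L \<and> (\<forall>z\<in>L. inner (y - p) z = 0))"

definition orthonormal_list :: "'a::euclidean_space list \<Rightarrow> bool" where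
  "orthonormal_list us \<longleftrightarrow>
     (\<forall>j<length us. norm (us ! j) = 1) \<and>
     (\<forall>i<length us. \<forall>j<length us. i \<noteq> j \<longrightarrow> inner (us ! i) (us ! j) = 0)"

definition frenet_residual :: "(nat \<Rightarrow> 'a::euclidean_space) \<Rightarrow> 'a \<Rightarrow> 'a list \<Rightarrow> nat \<Rightarrow> nat \<Rightarrow> 'a" where
  "frenet_residual xs x us j i =
     xs i - x - proj (span (set (take j us))) (xs i - x)"

text \<open>us = [u_1,...,u_k] (k \<ge> 1) is the Frenet k-frame of the sequence xs converging to x.
  For j = 0 the residual is xs i - x (projection onto the zero space), so the j = 0
  clause is exactly the Frenet 1-frame condition.\<close>
definition frenet_frame :: "(nat \<Rightarrow> 'a::euclidean_space) \<Rightarrow> 'a \<Rightarrow> 'a list \<Rightarrow> bool" where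
  "frenet_frame xs x us \<longleftrightarrow>
     us \<noteq> [] \<and> orthonormal_list us \<and> xs \<longlonglongrightarrow> x \<and> (\<forall>i. xs i \<noteq> x) \<and>
     (\<forall>j<length us.
        (\<forall>i. frenet_residual xs x us j i \<noteq> 0) \<and>
        (\<lambda>i. (1 / norm (frenet_residual xs x us j i)) *\<^sub>R frenet_residual xs x us j i)
          \<longlonglongrightarrow> us ! j)"

definition tangent :: "'a::euclidean_space set \<Rightarrow> 'a \<Rightarrow> 'a list \<Rightarrow> bool" where
  "tangent X x us \<longleftrightarrow>
     length us \<ge> 1 \<and> orthonormal_list us \<and>
     (\<exists>xs. (\<forall>i. xs i \<in> X) \<and> xs \<longlonglongrightarrow> x \<and> frenet_frame xs x us)"

definition frame_vertex :: "'a::euclidean_space \<Rightarrow> (nat \<Rightarrow> real) \<Rightarrow> 'a list \<Rightarrow> nat \<Rightarrow> 'a" where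
  "frame_vertex x lam us m = x + (\<Sum>j<m. lam j *\<^sub>R us ! j)"

definition outgoing_tangent :: "'a::euclidean_space set \<Rightarrow> 'a \<Rightarrow> 'a list \<Rightarrow> bool" where
  "outgoing_tangent X x us \<longleftrightarrow>
     tangent X x us \<and>
     (\<exists>lam. (\<forall>j<length us. lam j > 0) \<and>
        (let C  = convex hull {frame_vertex x lam us m | m. m \<le> length us};
             C' = convex hull {frame_vertex x lam us m | m. m < length us}
         in C \<inter> X = C' \<inter> X))"

definition is_cube :: "'a::euclidean_space set \<Rightarrow> bool" where
  "is_cube K \<longleftrightarrow> (\<exists>a r. r > 0 \<and> K = cbox a (a + r *\<^sub>R One))"

definition pl_on :: "'a::euclidean_space set \<Rightarrow> ('a \<Rightarrow> real) \<Rightarrow> bool" where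
  "pl_on K g \<longleftrightarrow>
     continuous_on K g \<and>
     (\<exists>\<T>. triangulation \<T> \<and> \<Union>\<T> = K \<and>
        (\<forall>T\<in>\<T>. \<exists>c d. \<forall>y\<in>T. g y = inner c y + d))"

text \<open>The Riesz space R(X): restrictions to X of piecewise linear functions on a
  closed cube containing X.  Functions on X are represented as functions on the
  whole space that vanish outside X.\<close>
definition RX :: "'a::euclidean_space set \<Rightarrow> ('a \<Rightarrow> real) set" where
  "RX X = {f. \<exists>K g. is_cube K \<and> X \<subseteq> K \<and> pl_on K g \<and>
                   f = (\<lambda>y. if y \<in> X then g y else 0)}"

definition riesz_ideal :: "'a::euclidean_space set \<Rightarrow> ('a \<Rightarrow> real) set \<Rightarrow> bool" where
  "riesz_ideal X I \<longleftrightarrow>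
     I \<subseteq> RX X \<and> (\<lambda>_. 0) \<in> I \<and>
     (\<forall>f\<in>I. \<forall>g\<in>I. (\<lambda>y. f y + g y) \<in> I) \<and>
     (\<forall>f\<in>I. \<forall>c::real. (\<lambda>y. c * f y) \<in> I) \<and>
     (\<forall>f\<in>I. \<forall>g\<in>RX X. (\<forall>y\<in>X. \<bar>g y\<bar> \<le> \<bar>f y\<bar>) \<longrightarrow> g \<in> I)"

definition maximal_ideal :: "'a::euclidean_space set \<Rightarrow> ('a \<Rightarrow> real) set \<Rightarrow> bool" where
  "maximal_ideal X I \<longleftrightarrow>
     riesz_ideal X I \<and> I \<noteq> RX X \<and>
     (\<forall>J. riesz_ideal X J \<and> I \<subseteq> J \<longrightarrow> J = I \<or> J = RX X)"

definition principal_ideal :: "'a::euclidean_space set \<Rightarrow> ('a \<Rightarrow> real) \<Rightarrow> ('a \<Rightarrow> real) set" where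
  "principal_ideal X g = {f \<in> RX X. \<exists>m::nat. \<forall>y\<in>X. \<bar>f y\<bar> \<le> real m * \<bar>g y\<bar>}"

text \<open>Strongly semisimple: every principal ideal is an intersection of maximal
  ideals (the empty intersection being the whole space R(X)).\<close>
definition strongly_semisimple :: "'a::euclidean_space set \<Rightarrow> bool" where
  "strongly_semisimple X \<longleftrightarrow>
     (\<forall>g\<in>RX X. \<exists>\<M>. (\<forall>M\<in>\<M>. maximal_ideal X M) \<and>
        principal_ideal X g = RX X \<inter> \<Inter>\<M>)"

end

theory Submission
  imports Defs
begin

text \<open>
  The maximal ideals of \<open>\<R>(X)\<close> are the point ideals \<open>{f. f x = 0}\<close>, so \<open>\<R>(X)\<close> fails to be strongly
  semisimple iff there are \<open>f, g\<close> in it such that \<open>f\<close> vanishes wherever \<open>g\<close> does but \<open>\<bar>f\<bar> \<le> m \<bar>g\<bar>\<close>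
  holds for no \<open>m\<close>.

  Given an outgoing tangent with simplices \<open>C' \<subseteq> C\<close>, take \<open>f\<close> linear with value zero on \<open>C'\<close> and \<open>g\<close> with
  zero set \<open>C\<close>; along the sequence \<open>g\<close> is bounded by the Frenet residual, which is negligible against
  the last Frenet coordinate \<open>f\<close>.

  Conversely, pick \<open>x_i\<close> in \<open>X\<close> with \<open>\<bar>f x_i\<bar> > i \<bar>g x_i\<bar>\<close>, all in one polyhedron on which \<open>f\<close> and \<open>g\<close> are
  affine, converging to some \<open>x\<close> and having a Frenet frame that exhausts all the differences
  \<open>x_i - x\<close>. Each coordinate is negligible against the previous one, so the sign and the size of an
  affine function along the sequence are those of its first nonvanishing Frenet coefficient. Hence
  \<open>g\<close> has zero slope in every direction up to the first one in which \<open>f\<close> has nonzero slope, and the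
  frame truncated there is an outgoing tangent.
\<close>

subsection \<open>Piecewise linear functions without triangulations\<close>

text \<open>Slope and constant term are stored as a pair, so that sums and multiples of affine
  functions are sums and multiples of pairs and a finite family of pieces is a finite set.\<close>

definition aff :: "'a::euclidean_space \<times> real \<Rightarrow> 'a \<Rightarrow> real" where
  "aff p y = fst p \<bullet> y + snd p"

text \<open>A continuous selection of finitely many affine functions, defined on the whole space. Unlike
  \<^const>\<open>pl_on\<close> this mentions no triangulation, so closure under the Riesz space operations is
  immediate.\<close>
definition pwl :: "('a::euclidean_space \<Rightarrow> real) \<Rightarrow> bool" where
  "pwl g \<longleftrightarrow> continuous_on UNIV g \<and> (\<exists>A. finite A \<and> (\<forall>y. \<exists>p\<in>A. g y = aff p y))"

lemma continuous_on_aff [continuous_intros]: "continuous_on S (aff p)"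
  unfolding aff_def [abs_def] by (intro continuous_intros)

lemma aff_affine: "u + v = 1 \<Longrightarrow> aff p (u *\<^sub>R x + v *\<^sub>R y) = u * aff p x + v * aff p y"
  unfolding aff_def inner_add_right inner_scaleR_right distrib_left
  by (simp flip: distrib_right)

lemma pwl_continuous: "pwl g \<Longrightarrow> continuous_on S g"
  unfolding pwl_def using continuous_on_subset by blast

lemma pwl_aff: "pwl (aff p)"
  unfolding pwl_def by (auto intro!: continuous_intros exI[of _ "{p}"])

lemma pwl_inner: "pwl (\<lambda>y. c \<bullet> y + d)"
  using pwl_aff[of "(c, d)"] by (simp add: aff_def[abs_def])

lemma pwl_const: "pwl (\<lambda>y. d)"
  using pwl_inner[of 0 d] by simp

lemma pwl_add:
  assumes "pwl f" "pwl g" shows "pwl (\<lambda>y. f y + g y)"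
proof -
  obtain A where A: "finite A" "\<And>y. \<exists>p\<in>A. f y = aff p y"
    using assms unfolding pwl_def by blast
  obtain B where B: "finite B" "\<And>y. \<exists>p\<in>B. g y = aff p y"
    using assms unfolding pwl_def by blast
  have "\<exists>r\<in>(\<lambda>(p, q). p + q) ` (A \<times> B). f y + g y = aff r y" for y
  proof -
    obtain p q where "p \<in> A" "f y = aff p y" "q \<in> B" "g y = aff q y"
      using A B by meson
    then show ?thesis
      by (intro bexI[of _ "p + q"]) (auto simp: aff_def inner_add_left intro!: rev_image_eqI)
  qed
  moreover have "continuous_on UNIV (\<lambda>y. f y + g y)"
    using assms by (intro continuous_intros pwl_continuous)
  ultimately show ?thesis
    unfolding pwl_def using A(1) B(1) by (intro conjI exI[of _ "(\<lambda>(p, q). p + q) ` (A \<times> B)"]) auto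
qed

lemma pwl_scale:
  assumes "pwl f" shows "pwl (\<lambda>y. c * f y)"
proof -
  obtain A where A: "finite A" "\<And>y. \<exists>p\<in>A. f y = aff p y"
    using assms unfolding pwl_def by blast
  have "\<exists>r\<in>(\<lambda>p. c *\<^sub>R p) ` A. c * f y = aff r y" for y
  proof -
    obtain p where "p \<in> A" "f y = aff p y" using A(2) by blast
    then show ?thesis by (auto simp: aff_def algebra_simps intro!: bexI[of _ p])
  qed
  moreover have "continuous_on UNIV (\<lambda>y. c * f y)"
    using assms by (intro continuous_intros pwl_continuous)
  ultimately show ?thesis
    unfolding pwl_def using A(1) by (intro conjI exI[of _ "(\<lambda>p. c *\<^sub>R p) ` A"]) auto
qed

lemma pwl_sum:
  "(\<And>i. i \<in> I \<Longrightarrow> pwl (f i)) \<Longrightarrow> pwl (\<lambda>y. \<Sum>i\<in>I. f i y)"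
  by (induction I rule: infinite_finite_induct) (auto intro: pwl_const pwl_add)

text \<open>Gluing principle: the affine pieces of the selected functions together serve for
  \<open>g\<close>, and only continuity has to be supplied. The lattice operations and the extension
  from a cube are instances.\<close>

lemma pwl_select:
  assumes "continuous_on UNIV g" "finite P" "\<And>f. f \<in> P \<Longrightarrow> pwl f" "\<And>y. \<exists>f\<in>P. g y = f y"
  shows "pwl g"
proof -
  have "\<forall>f\<in>P. \<exists>A. finite A \<and> (\<forall>y. \<exists>p\<in>A. f y = aff p y)"
    using assms(3) unfolding pwl_def by blast
  then obtain A where A: "\<And>f. f \<in> P \<Longrightarrow> finite (A f)"
      "\<And>f y. f \<in> P \<Longrightarrow> \<exists>p\<in>A f. f y = aff p y"
    by metis
  show ?thesis
    unfolding pwl_def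
  proof (intro conjI exI[of _ "\<Union>f\<in>P. A f"] allI)
    show "\<exists>p\<in>\<Union>f\<in>P. A f. g y = aff p y" for y
      using assms(4)[of y] A(2) by fastforce
  qed (use assms A in auto)
qed

lemma pwl_max:
  assumes "pwl f" "pwl g" shows "pwl (\<lambda>y. max (f y) (g y))"
proof (rule pwl_select[of _ "{f, g}"])
  show "continuous_on UNIV (\<lambda>y. max (f y) (g y))"
    using assms by (intro continuous_intros pwl_continuous)
qed (use assms in \<open>auto simp: max_def\<close>)

lemma pwl_min:
  assumes "pwl f" "pwl g" shows "pwl (\<lambda>y. min (f y) (g y))"
proof (rule pwl_select[of _ "{f, g}"])
  show "continuous_on UNIV (\<lambda>y. min (f y) (g y))"
    using assms by (intro continuous_intros pwl_continuous)
qed (use assms in \<open>auto simp: min_def\<close>)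

lemma pwl_abs:
  assumes "pwl f" shows "pwl (\<lambda>y. \<bar>f y\<bar>)"
proof -
  have "\<bar>f y\<bar> = max (f y) (- 1 * f y)" for y by auto
  then show ?thesis
    using pwl_max[OF assms pwl_scale[OF assms, of "-1"]] by presburger
qed

text \<open>Clamping truncates each coordinate by \<open>max\<close> and \<open>min\<close>, so the
  composite is a sum of scaled truncations. This makes the retraction onto a box available for
  extending functions.\<close>

lemma pwl_aff_clamp:
  assumes "cbox a b \<noteq> {}" shows "pwl (\<lambda>y. aff p (clamp a b y))"
proof -
  have le: "a \<bullet> i \<le> b \<bullet> i" if "i \<in> Basis" for i
    using assms that by (simp add: box_ne_empty)
  have cl: "clamp a b y = (\<Sum>i\<in>Basis. max (a \<bullet> i) (min (i \<bullet> y) (b \<bullet> i)) *\<^sub>R i)" for y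
    unfolding clamp_def using le by (auto simp: inner_commute intro!: sum.cong)
  have "aff p (clamp a b y) =
      (\<Sum>i\<in>Basis. (fst p \<bullet> i) * max (a \<bullet> i) (min (i \<bullet> y + 0) (b \<bullet> i))) + snd p" for y
    unfolding cl aff_def by (simp add: inner_sum_right mult.commute)
  then show ?thesis
    by (simp only:) (intro pwl_add pwl_sum pwl_scale pwl_max pwl_min pwl_inner pwl_const)
qed

section \<open>From affine selections to triangulations and back\<close>

text \<open>Two comparable pieces that agree at one relative interior point agree on all of
  \<open>S\<close>, because their difference is affine of constant sign. Hence the agreement sets of
  \<open>g\<close> with the pieces are finitely many closed subsets of the relative interior, any
  two equal or disjoint, and connectedness leaves a single nonempty one. Continuity carries the
  equality to the closure.\<close>

lemma affine_selection_on_cell: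
  fixes S :: "'a::euclidean_space set"
  assumes "convex S" "closed S" "continuous_on S g" "finite A"
    and sel: "\<And>y. y \<in> S \<Longrightarrow> \<exists>p\<in>A. g y = aff p y"
    and sides: "\<And>p q. p \<in> A \<Longrightarrow> q \<in> A \<Longrightarrow>
        (\<forall>y\<in>S. aff p y \<le> aff q y) \<or> (\<forall>y\<in>S. aff q y \<le> aff p y)"
  shows "\<exists>p. \<forall>y\<in>S. g y = aff p y"
proof (cases "S = {}")
  case False
  define R where "R = rel_interior S"
  have R: "R \<subseteq> S" "connected R" "R \<noteq> {}" "S \<subseteq> closure R"
    using False assms(1,2) convex_closure_rel_interior[OF assms(1)] closure_subset
    by (auto simp: R_def rel_interior_subset convex_connected convex_rel_interior rel_interior_eq_empty)
  have le0: "aff q y \<le> aff p y" if "\<forall>y\<in>S. aff p y \<le> aff q y" "aff p z = aff q z" "z \<in> R" "y \<in> S"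
    for p q y z
  proof -
    \<comment> \<open>The segment from \<open>y\<close> can be prolonged beyond the relative
      interior point \<open>z\<close>. As the pieces agree at \<open>z\<close>, the inequality at
      the new point reverses at \<open>y\<close>.\<close>
    obtain e where e: "e > 1" "(1 - e) *\<^sub>R y + e *\<^sub>R z \<in> S"
      using convex_rel_interior_if[OF assms(1), of z] \<open>z \<in> R\<close> \<open>y \<in> S\<close>
      unfolding R_def by (metis convex_rel_interior_iff[OF assms(1) False])
    then have "(1 - e) * aff p y + e * aff p z \<le> (1 - e) * aff q y + e * aff q z"
      using that(1) by (metis aff_affine diff_add_cancel)
    then have "(e - 1) * aff q y \<le> (e - 1) * aff p y" using that(2) by (simp add: algebra_simps)
    then show ?thesis using e by simp
  qed
  have eq: "aff p y = aff q y" if "p \<in> A" "q \<in> A" "aff p z = aff q z" "z \<in> R" "y \<in> S" for p q y z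
    using sides[of p q] le0[of p q z y] le0[of q p z y] that by force
  obtain z where z: "z \<in> R" using R by blast
  then obtain p where p: "p \<in> A" "g z = aff p z" using sel R by blast
  define Z where "Z q = {y \<in> R. g y - aff q y = 0}" for q
  have cont: "continuous_on S (\<lambda>y. g y - aff q y)" for q
    using assms by (intro continuous_intros)
  have clo: "closedin (top_of_set R) (Z q)" for q
    unfolding Z_def 
    by (intro continuous_closedin_preimage_constant continuous_on_subset[OF cont R(1)])
  \<comment> \<open>The complement of \<open>Z p\<close> is the finite union of the agreement sets
    that miss it, so \<open>Z p\<close> is open as well as closed in \<open>R\<close>.\<close>
  define B where "B = {q\<in>A. Z p \<inter> Z q = {}}"
  have "R - Z p = (\<Union>q\<in>B. Z q)"
  proof (intro equalityI subsetI)
    fix y assume y: "y \<in> R - Z p"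
    then obtain q where q: "q \<in> A" "g y = aff q y" using sel R by blast
    have "Z p \<inter> Z q = {}"
    proof (rule ccontr)
      assume "Z p \<inter> Z q \<noteq> {}"
      then obtain w where "w \<in> Z p" "w \<in> Z q" by blast
      then have "w \<in> R" "aff p w = aff q w" by (auto simp: Z_def)
      then have "aff p y = aff q y" using eq p(1) q(1) y R by blast
      then show False using y q by (auto simp: Z_def)
    qed
    then have "q \<in> B" using q by (simp add: B_def)
    moreover have "y \<in> Z q" using q y by (simp add: Z_def)
    ultimately show "y \<in> (\<Union>q\<in>B. Z q)" by blast
  qed (auto simp: B_def Z_def)
  moreover have "closedin (top_of_set R) (\<Union>q\<in>B. Z q)"
    using assms(4) clo by (intro closedin_Union) (auto simp: B_def)
  ultimately have "openin (top_of_set R) (Z p)"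
    by (auto simp: openin_closedin_eq Z_def)
  moreover have "z \<in> Z p" using z p by (simp add: Z_def)
  ultimately have "Z p = R"
    using clo[of p] R(2) unfolding connected_clopen by blast
  then have "R \<subseteq> {y\<in>S. g y - aff p y = 0}" using R(1) by (auto simp: Z_def)
  moreover have "closed {y\<in>S. g y - aff p y = 0}"
    by (intro continuous_closed_preimage_constant cont assms)
  ultimately have "S \<subseteq> {y\<in>S. g y - aff p y = 0}"
    using R(4) closure_minimal by blast
  then show ?thesis by (intro exI[of _ p]) auto
qed auto

text \<open>Cutting the polytope along all hyperplanes where two of the affine pieces agree gives cells on
  which the pieces are linearly ordered, so \<open>g\<close> follows a single piece on each cell.\<close>
lemma pwl_imp_pl_on:
  fixes K :: "'a::euclidean_space set"
  assumes "pwl g" "polytope K"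
  shows "pl_on K g"
proof -
  obtain A where A: "finite A" "\<And>y. \<exists>p\<in>A. g y = aff p y"
    using assms unfolding pwl_def by blast
  define I where "I = (\<lambda>(p, q). (fst p - fst q, snd q - snd p)) ` (A \<times> A)"
  have "finite I" using A by (simp add: I_def)
  obtain \<G> where G: "\<Union>\<G> = K" "finite \<G>" "\<And>X. X \<in> \<G> \<Longrightarrow> polytope X"
      "\<And>X Y. X \<in> \<G> \<Longrightarrow> Y \<in> \<G> \<Longrightarrow> X \<inter> Y face_of X"
      and side: "\<And>X x y a b. X \<in> \<G> \<Longrightarrow> x \<in> X \<Longrightarrow> y \<in> X \<Longrightarrow> (a, b) \<in> I \<Longrightarrow>
          a \<bullet> x \<le> b \<and> a \<bullet> y \<le> b \<or> a \<bullet> x \<ge> b \<and> a \<bullet> y \<ge> b"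
    using cell_subdivision_lemma[of "{K}" "DIM('a)" I] assms \<open>finite I\<close> aff_dim_le_DIM[of K]
    by (simp add: face_of_refl polytope_imp_convex) metis
  \<comment> \<open>Every simplex lies inside a cell, so affinity on the cells passes to the
    triangulation.\<close>
  obtain \<T> where T: "simplicial_complex \<T>" "\<Union>\<T> = \<Union>\<G>" "\<And>T. T \<in> \<T> \<Longrightarrow> \<exists>C. C \<in> \<G> \<and> T \<subseteq> C"
    using simplicial_subdivision_of_cell_complex[of \<G>] G by metis
  have "\<exists>p. \<forall>y\<in>C. g y = aff p y" if C: "C \<in> \<G>" for C
  proof (rule affine_selection_on_cell)
    show "convex C" "closed C" 
      using G(3)[OF C] by (auto simp: polytope_imp_convex polytope_imp_closed)
    show "continuous_on C g" by (rule pwl_continuous[OF assms(1)])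
    show "finite A" "\<And>y. y \<in> C \<Longrightarrow> \<exists>p\<in>A. g y = aff p y" using A by auto
    show "(\<forall>y\<in>C. aff p y \<le> aff q y) \<or> (\<forall>y\<in>C. aff q y \<le> aff p y)" if "p \<in> A" "q \<in> A" for p q
    proof -
      have "(fst p - fst q, snd q - snd p) \<in> I" unfolding I_def using that by force
      from side[OF C _ _ this]
      have "aff p x \<le> aff q x \<and> aff p y \<le> aff q y \<or> aff p x \<ge> aff q x \<and> aff p y \<ge> aff q y"
        if "x \<in> C" "y \<in> C" for x y
        using that by (fastforce simp: aff_def algebra_simps inner_diff_left)
      then show ?thesis by (meson linear order_trans)
    qed
  qed
  then have "\<exists>c d. \<forall>y\<in>T. g y = c \<bullet> y + d" if "T \<in> \<T>" for T
    using T(3)[OF that] unfolding aff_def by (meson subset_iff)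
  moreover have "triangulation \<T>"
    using T(1) by (auto simp: triangulation_def simplicial_complex_def)
  ultimately show ?thesis
    unfolding pl_on_def using T(2) G(1) pwl_continuous[OF assms(1)] by metis
qed

text \<open>Frees the Riesz space from cubes and triangulations. Boundedness provides a cube around
  \<open>X\<close>.\<close>

lemma RX_eq:
  fixes X :: "'a::euclidean_space set"
  assumes "bounded X"
  shows "RX X = {\<lambda>y. if y \<in> X then g y else 0 |g. pwl g}"
proof (intro equalityI subsetI)
  fix f assume "f \<in> RX X"
  then obtain K g where K: "is_cube K" "X \<subseteq> K" "pl_on K g" and f: "f = (\<lambda>y. if y \<in> X then g y else 0)"
    unfolding RX_def by blast
  obtain a b where ab: "K = cbox a b" "cbox a b \<noteq> {}"
  proof -
    obtain a r where "r > 0" "K = cbox a (a + r *\<^sub>R One)"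
      using K(1) unfolding is_cube_def by blast
    then show ?thesis using that[of a "a + r *\<^sub>R One"] by (simp add: box_ne_empty inner_add_left)
  qed
  obtain \<T> where T: "triangulation \<T>" "\<Union>\<T> = K" "\<And>T. T \<in> \<T> \<Longrightarrow> \<exists>c d. \<forall>y\<in>T. g y = c \<bullet> y + d"
    and cont: "continuous_on K g"
    using K(3) unfolding pl_on_def by blast
  have "\<forall>T\<in>\<T>. \<exists>p. \<forall>y\<in>T. g y = aff p y"
    using T(3) by (fastforce simp: aff_def)
  then obtain P where P: "\<And>T y. T \<in> \<T> \<Longrightarrow> y \<in> T \<Longrightarrow> g y = aff (P T) y" by metis
  txt \<open>Retracting onto \<open>K\<close> extends \<open>g\<close> to the whole space, so different cubes need not be compared.\<close>
  have "pwl (\<lambda>y. g (clamp a b y))"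
  proof (rule pwl_select)
    show "continuous_on UNIV (\<lambda>y. g (clamp a b y))"
      using cont ab by (intro clamp_continuous_on) auto
    show "finite ((\<lambda>T y. aff (P T) (clamp a b y)) ` \<T>)"
      using T(1) by (simp add: triangulation_def)
    show "pwl h" if "h \<in> (\<lambda>T y. aff (P T) (clamp a b y)) ` \<T>" for h
      using that by (auto simp only: intro!: pwl_aff_clamp[OF ab(2)])
    show "\<exists>h\<in>(\<lambda>T y. aff (P T) (clamp a b y)) ` \<T>. g (clamp a b y) = h y" for y
    proof -
      have "clamp a b y \<in> \<Union>\<T>"
        using T(2) ab by (auto intro!: clamp_in_interval simp: box_ne_empty)
      then show ?thesis using P by auto
    qed
  qed
  moreover have "f = (\<lambda>y. if y \<in> X then g (clamp a b y) else 0)"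
    using K(2) ab f by fastforce
  ultimately show "f \<in> {\<lambda>y. if y \<in> X then g y else 0 |g. pwl g}"
    by (intro CollectI exI[of _ "\<lambda>y. g (clamp a b y)"]) simp
next
  fix f assume "f \<in> {\<lambda>y. if y \<in> X then g y else 0 |g. pwl g}"
  then obtain g where g: "pwl g" and f: "f = (\<lambda>y. if y \<in> X then g y else 0)" by blast
  obtain B where B: "B > 0" "\<And>x. x \<in> X \<Longrightarrow> norm x \<le> B"
    using assms unfolding bounded_pos by blast
  define K :: "'a set" where "K = cbox (-B *\<^sub>R One) (-B *\<^sub>R One + (2*B) *\<^sub>R One)"
  have "is_cube K" unfolding is_cube_def K_def using B by (intro exI[of _ "-B *\<^sub>R One"] exI[of _ "2*B"]) auto
  moreover have "X \<subseteq> K"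
  proof
    fix x assume "x \<in> X"
    then have "\<bar>x \<bullet> i\<bar> \<le> B" if "i \<in> Basis" for i
      using B(2) Basis_le_norm[OF that, of x] by force
    then show "x \<in> K" by (force simp: K_def mem_box inner_add_left inner_diff_left)
  qed
  moreover have "pl_on K g" using g unfolding K_def by (intro pwl_imp_pl_on polytope_interval)
  ultimately show "f \<in> RX X" unfolding RX_def using f by blast
qed

subsection \<open>Ideals\<close>

lemma RX_vanishes: "f \<in> RX X \<Longrightarrow> y \<notin> X \<Longrightarrow> f y = 0"
  by (auto simp: RX_def)

lemma RX_obtain_pwl:
  assumes "bounded X" "f \<in> RX X"
  obtains g where "pwl g" "\<And>y. y \<in> X \<Longrightarrow> f y = g y"
  using assms by (auto simp: RX_eq)

lemma RX_I:
  assumes "bounded X" "pwl g" "\<And>y. y \<in> X \<Longrightarrow> f y = g y" "\<And>y. y \<notin> X \<Longrightarrow> f y = 0"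
  shows "f \<in> RX X"
proof -
  have "f = (\<lambda>y. if y \<in> X then g y else 0)" using assms by fastforce
  then show ?thesis unfolding RX_eq[OF assms(1)] using assms(2) by blast
qed

lemma RX_add:
  assumes "bounded X" "f \<in> RX X" "g \<in> RX X"
  shows "(\<lambda>y. f y + g y) \<in> RX X"
proof -
  obtain f' where f': "pwl f'" "\<And>y. y \<in> X \<Longrightarrow> f y = f' y" using RX_obtain_pwl assms by metis
  obtain g' where g': "pwl g'" "\<And>y. y \<in> X \<Longrightarrow> g y = g' y" using RX_obtain_pwl assms by metis
  show ?thesis
    by (rule RX_I[OF assms(1) pwl_add[OF f'(1) g'(1)]]) (use f' g' assms in \<open>auto simp: RX_vanishes\<close>)
qed

lemma RX_scale:
  assumes "bounded X" "f \<in> RX X"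
  shows "(\<lambda>y. c * f y) \<in> RX X"
proof -
  obtain f' where f': "pwl f'" "\<And>y. y \<in> X \<Longrightarrow> f y = f' y" using RX_obtain_pwl assms by metis
  show ?thesis
    by (rule RX_I[OF assms(1) pwl_scale[OF f'(1)]]) (use f' assms in \<open>auto simp: RX_vanishes\<close>)
qed

lemma RX_abs:
  assumes "bounded X" "f \<in> RX X"
  shows "(\<lambda>y. \<bar>f y\<bar>) \<in> RX X"
proof -
  obtain f' where f': "pwl f'" "\<And>y. y \<in> X \<Longrightarrow> f y = f' y" using RX_obtain_pwl assms by metis
  show ?thesis
    by (rule RX_I[OF assms(1) pwl_abs[OF f'(1)]]) (use f' assms in \<open>auto simp: RX_vanishes\<close>)
qed

lemma RX_zero: "bounded X \<Longrightarrow> (\<lambda>_. 0) \<in> RX X"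
  by (rule RX_I[OF _ pwl_const]) auto

lemma RX_continuous:
  assumes "bounded X" "f \<in> RX X"
  shows "continuous_on X f"
proof -
  obtain f' where f': "pwl f'" "\<And>y. y \<in> X \<Longrightarrow> f y = f' y" using RX_obtain_pwl assms by metis
  then show ?thesis using continuous_on_cong pwl_continuous by metis
qed

lemma RX_bounded:
  assumes "compact X" "f \<in> RX X"
  obtains B where "B > 0" "\<And>y. y \<in> X \<Longrightarrow> \<bar>f y\<bar> \<le> B"
proof -
  have "bounded (f ` X)"
    using assms by (intro compact_imp_bounded compact_continuous_image RX_continuous)
  then show ?thesis using that unfolding bounded_pos by auto
qed

section \<open>Maximal ideals as ideals of points\<close>

lemma riesz_idealD:
  assumes "riesz_ideal X I"
  shows riesz_ideal_subset: "I \<subseteq> RX X"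
    and riesz_ideal_add: "f \<in> I \<Longrightarrow> g \<in> I \<Longrightarrow> (\<lambda>y. f y + g y) \<in> I"
    and riesz_ideal_scale: "f \<in> I \<Longrightarrow> (\<lambda>y. c * f y) \<in> I"
    and riesz_ideal_solid: "f \<in> I \<Longrightarrow> g \<in> RX X \<Longrightarrow> (\<And>y. y \<in> X \<Longrightarrow> \<bar>g y\<bar> \<le> \<bar>f y\<bar>) \<Longrightarrow> g \<in> I"
  using assms by (simp_all add: riesz_ideal_def)

definition point_ideal :: "'a::euclidean_space set \<Rightarrow> 'a \<Rightarrow> ('a \<Rightarrow> real) set" where
  "point_ideal X x = {f \<in> RX X. f x = 0}"

lemma riesz_ideal_point_ideal: "bounded X \<Longrightarrow> x \<in> X \<Longrightarrow> riesz_ideal X (point_ideal X x)"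
  unfolding riesz_ideal_def point_ideal_def by (auto simp: RX_zero RX_add RX_scale)

lemma point_ideal_proper:
  assumes "bounded X" "x \<in> X" shows "point_ideal X x \<noteq> RX X"
proof -
  have "(\<lambda>y. if y \<in> X then 1 else 0) \<in> RX X" (is "?e \<in> _")
    using assms by (intro RX_I[OF _ pwl_const[of 1]]) auto
  moreover have "?e \<notin> point_ideal X x" using assms by (simp add: point_ideal_def)
  ultimately show ?thesis by metis
qed

text \<open>If a larger ideal contains some \<open>f\<close> with \<open>f x \<noteq> 0\<close>,
  then every \<open>h\<close> differs from a multiple of \<open>f\<close> by a function vanishing at
  \<open>x\<close>, so that ideal is everything.\<close>

lemma maximal_point_ideal:
  assumes "bounded X" "x \<in> X"
  shows "maximal_ideal X (point_ideal X x)"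
  unfolding maximal_ideal_def
proof (intro conjI allI impI riesz_ideal_point_ideal point_ideal_proper assms)
  fix J assume "riesz_ideal X J \<and> point_ideal X x \<subseteq> J"
  then have J: "riesz_ideal X J" "point_ideal X x \<subseteq> J" by auto
  show "J = point_ideal X x \<or> J = RX X"
  proof (rule disjCI)
    assume "J \<noteq> RX X"
    have "f x = 0" if f: "f \<in> J" for f
    proof (rule ccontr)
      assume "f x \<noteq> 0"
      have fR: "f \<in> RX X" using J f by (auto simp: riesz_ideal_def)
      have "h \<in> J" if h: "h \<in> RX X" for h
      proof -
        define c where "c = h x / f x"
        have "(\<lambda>y. h y + (- c) * f y) \<in> RX X"
          by (intro RX_add RX_scale assms fR h)
        then have "(\<lambda>y. h y + (- c) * f y) \<in> point_ideal X x"
          using \<open>f x \<noteq> 0\<close> by (simp add: point_ideal_def c_def)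
        from riesz_ideal_add[OF J(1) subsetD[OF J(2) this] riesz_ideal_scale[OF J(1) f, of c]]
        show "h \<in> J" by simp
      qed
      then show False using \<open>J \<noteq> RX X\<close> J by (auto simp: riesz_ideal_def)
    qed
    then show "J = point_ideal X x" using J by (auto simp: riesz_ideal_def point_ideal_def)
  qed
qed

text \<open>Without a common zero, compactness yields finitely many members whose nonvanishing sets
  cover \<open>X\<close>. The sum of their absolute values is a member bounded away from zero on
  \<open>X\<close>, and its multiples dominate every bounded function. Consequently each maximal
  ideal lies in a point ideal, hence equals it.\<close>

lemma riesz_ideal_common_zero:
  assumes "compact X" "riesz_ideal X I" "I \<noteq> RX X"
  shows "\<exists>x\<in>X. \<forall>f\<in>I. f x = 0"
proof (rule ccontr)
  assume "\<not> (\<exists>x\<in>X. \<forall>f\<in>I. f x = 0)"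
  then obtain h where h: "\<And>x. x \<in> X \<Longrightarrow> h x \<in> I" "\<And>x. x \<in> X \<Longrightarrow> h x x \<noteq> 0"
    by metis
  have bX: "bounded X" using assms(1) compact_imp_bounded by blast
  have IR: "I \<subseteq> RX X" using assms(2) by (simp add: riesz_ideal_def)
  \<comment> \<open>As \<open>h x\<close> is set to zero off \<open>X\<close>, it may jump there. A
    globally continuous representative makes the nonvanishing set open.\<close>
  have "\<exists>g. pwl g \<and> (\<forall>y\<in>X. h x y = g y)" if "x \<in> X" for x
  proof -
    have "h x \<in> RX X" using h(1)[OF that] IR by blast
    then show ?thesis by (rule RX_obtain_pwl[OF bX]) blast
  qed
  then obtain g where g: "\<And>x. x \<in> X \<Longrightarrow> pwl (g x)" "\<And>x y. x \<in> X \<Longrightarrow> y \<in> X \<Longrightarrow> h x y = g x y"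
    by metis
  have op: "open {y. g x y \<noteq> 0}" if "x \<in> X" for x
    using g(1)[OF that] by (intro open_Collect_neq pwl_continuous continuous_on_const)
  have "X \<subseteq> (\<Union>x\<in>X. {y. g x y \<noteq> 0})" using g(2) h(2) by fastforce
  then obtain C where C: "C \<subseteq> X" "finite C" "X \<subseteq> (\<Union>x\<in>C. {y. g x y \<noteq> 0})"
    using compactE_image[OF assms(1), of X "\<lambda>x. {y. g x y \<noteq> 0}"] op by metis
  define F where "F = (\<lambda>y. \<Sum>x\<in>C. \<bar>h x y\<bar>)"
  have "F \<in> I"
    unfolding F_def using C(2,1)
  proof (induction C rule: finite_induct)
    case empty
    then show ?case using assms(2) by (simp add: riesz_ideal_def)
  next
    case (insert x C)
    have "(\<lambda>y. \<bar>h x y\<bar>) \<in> RX X" using insert h(1) IR bX by (blast intro: RX_abs)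
    then have "(\<lambda>y. \<bar>h x y\<bar>) \<in> I"
      using insert.prems by (intro riesz_ideal_solid[OF assms(2) h(1)[of x]]) auto
    then have "(\<lambda>y. \<bar>h x y\<bar> + (\<Sum>x\<in>C. \<bar>h x y\<bar>)) \<in> I"
      using insert by (intro riesz_ideal_add[OF assms(2)]) auto
    then show ?case using insert by simp
  qed
  have Fpos: "F y > 0" if "y \<in> X" for y
  proof -
    obtain x where "x \<in> C" "g x y \<noteq> 0" using C(3) \<open>y \<in> X\<close> by blast
    then show ?thesis unfolding F_def using g(2) C that by (intro sum_pos2[of _ x]) auto
  qed
  have "RX X \<subseteq> I"
  proof (cases "X = {}")
    case True
    then have "RX X \<subseteq> {\<lambda>_. 0}" using RX_vanishes[of _ X] by blast
    then show ?thesis using assms(2) by (auto simp: riesz_ideal_def)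
  next
    case False
    obtain z where z: "z \<in> X" "\<And>y. y \<in> X \<Longrightarrow> F z \<le> F y"
      using continuous_attains_inf[OF assms(1) False, of F] RX_continuous[OF bX] \<open>F \<in> I\<close> IR by blast
    show ?thesis
    proof
      fix f assume f: "f \<in> RX X"
      obtain B where B: "B > 0" "\<And>y. y \<in> X \<Longrightarrow> \<bar>f y\<bar> \<le> B" using RX_bounded[OF assms(1) f] by blast
      have le: "\<bar>f y\<bar> \<le> \<bar>(B / F z) * F y\<bar>" if "y \<in> X" for y
      proof -
        have "B = (B / F z) * F z" using Fpos[OF z(1)] by simp
        also have "\<dots> \<le> (B / F z) * F y" using z that B Fpos[OF z(1)] by (intro mult_left_mono) auto
        finally show ?thesis using B(2)[OF that] by linarith
      qed
      show "f \<in> I"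
        by (rule riesz_ideal_solid[OF assms(2) riesz_ideal_scale[OF assms(2) \<open>F \<in> I\<close>] f le])
    qed
  qed
  then show False using IR assms(3) by blast
qed

text \<open>The maximal ideals containing \<open>g\<close> are the point ideals at the zeros of
  \<open>g\<close>. So \<open>f\<close> separates the principal ideal from their intersection
  exactly when it vanishes at all these zeros without being dominated by a multiple of
  \<open>g\<close>.\<close>

lemma not_strongly_semisimple_iff:
  assumes "compact X"
  shows "\<not> strongly_semisimple X \<longleftrightarrow>
    (\<exists>f\<in>RX X. \<exists>g\<in>RX X. (\<forall>y\<in>X. g y = 0 \<longrightarrow> f y = 0) \<and> (\<forall>m::nat. \<exists>y\<in>X. \<bar>f y\<bar> > real m * \<bar>g y\<bar>))"
    (is "?L \<longleftrightarrow> ?R")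
proof
  have bX: "bounded X" by (rule compact_imp_bounded[OF assms])
  assume ?L
  then obtain g where g: "g \<in> RX X" and
    n: "\<nexists>\<M>. (\<forall>M\<in>\<M>. maximal_ideal X M) \<and> principal_ideal X g = RX X \<inter> \<Inter>\<M>"
    unfolding strongly_semisimple_def by (auto simp only: ball_simps)
  \<comment> \<open>This family contains every maximal ideal above \<open>g\<close>, so its
    intersection is the only candidate for the principal ideal.\<close>
  define \<M> where "\<M> = point_ideal X ` {x\<in>X. g x = 0}"
  have "principal_ideal X g \<noteq> RX X \<inter> \<Inter>\<M>"
    using n[unfolded not_ex, rule_format, of \<M>] by (auto simp: \<M>_def maximal_point_ideal bX)
  moreover have "principal_ideal X g \<subseteq> RX X \<inter> \<Inter>\<M>"
    unfolding principal_ideal_def \<M>_def point_ideal_def by force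
  ultimately obtain f where f: "f \<in> RX X" "f \<in> \<Inter>\<M>" "f \<notin> principal_ideal X g" by blast
  show ?R
  proof (rule bexI[OF bexI[OF conjI[OF ballI[OF impI] allI] g] f(1)])
    show "f y = 0" if "y \<in> X" "g y = 0" for y
      using f(2) that by (auto simp: \<M>_def point_ideal_def)
    show "\<exists>y\<in>X. \<bar>f y\<bar> > real m * \<bar>g y\<bar>" for m
      using f(1,3) unfolding principal_ideal_def by (simp add: not_le)
  qed
next
  have bX: "bounded X" by (rule compact_imp_bounded[OF assms])
  assume ?R
  then obtain f g where fg: "f \<in> RX X" "g \<in> RX X" "\<forall>y\<in>X. g y = 0 \<longrightarrow> f y = 0"
    and n: "\<forall>m::nat. \<exists>y\<in>X. \<bar>f y\<bar> > real m * \<bar>g y\<bar>"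
    by (elim bexE conjE) (rule that)
  show ?L
  proof
    assume "strongly_semisimple X"
    then obtain \<M> where M: "\<And>M. M \<in> \<M> \<Longrightarrow> maximal_ideal X M" "principal_ideal X g = RX X \<inter> \<Inter>\<M>"
      using fg(2) unfolding strongly_semisimple_def by metis
    have "f \<notin> principal_ideal X g" using n unfolding principal_ideal_def by (simp add: not_le)
    then obtain I where I: "I \<in> \<M>" "f \<notin> I" using M(2) fg(1) by blast
    have mI: "maximal_ideal X I" by (rule M(1)[OF I(1)])
    have rI: "riesz_ideal X I" "I \<noteq> RX X"
      and max: "riesz_ideal X J \<Longrightarrow> I \<subseteq> J \<Longrightarrow> J = I \<or> J = RX X" for J
      using mI by (simp_all add: maximal_ideal_def)
    obtain x where x: "x \<in> X" "\<forall>h\<in>I. h x = 0"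
      using riesz_ideal_common_zero[OF assms rI] by (rule bexE)
    have "I \<subseteq> point_ideal X x"
      using x riesz_ideal_subset[OF rI(1)] by (auto simp: point_ideal_def)
    then have "point_ideal X x = I"
      using max[OF riesz_ideal_point_ideal[OF bX x(1)]] point_ideal_proper[OF bX x(1)] by simp
    \<comment> \<open>Since \<open>g\<close> lies in \<open>I\<close>, the point \<open>x\<close> is
      a zero of \<open>g\<close>, hence of \<open>f\<close>, which puts \<open>f\<close> into
      \<open>I\<close>.\<close>
    moreover have "g \<in> principal_ideal X g"
      unfolding principal_ideal_def using fg(2) by (auto intro!: exI[of _ 1])
    then have "g \<in> I" using M(2) I(1) by blast
    ultimately show False using I(2) fg(1,3) x by (auto simp: point_ideal_def)
  qed
qed

subsection \<open>Frenet frames\<close>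

text \<open>For an orthonormal list this is the component of \<open>v\<close> orthogonal to the
  first \<open>j\<close> vectors. The explicit sum replaces the definite description behind
  \<open>proj\<close>.\<close>

definition frame_residual :: "'a::euclidean_space list \<Rightarrow> nat \<Rightarrow> 'a \<Rightarrow> 'a" where
  "frame_residual us j v = v - (\<Sum>l<j. (v \<bullet> us ! l) *\<^sub>R us ! l)"

lemma frame_residual_0 [simp]: "frame_residual us 0 v = v"
  by (simp add: frame_residual_def)

lemma frame_residual_Suc:
  "frame_residual us (Suc j) v = frame_residual us j v - (v \<bullet> us ! j) *\<^sub>R us ! j"
  by (simp add: frame_residual_def)

lemma frame_residual_append:
  "j \<le> length us \<Longrightarrow> frame_residual (us @ vs) j v = frame_residual us j v"
  unfolding frame_residual_def by (auto simp: nth_append intro!: sum.cong)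

text \<open>Moving the operator to a fixed \<open>w\<close> shows that the coordinates of the
  residual of \<open>y - x\<close> are affine functions of \<open>y\<close>.\<close>

lemma frame_residual_selfadjoint: "frame_residual us j v \<bullet> w = v \<bullet> frame_residual us j w"
  by (simp add: frame_residual_def inner_diff_left inner_diff_right inner_sum_left inner_sum_right
      mult.commute inner_commute)

lemma orthonormal_inner:
  assumes "orthonormal_list us" "i < length us" "j < length us"
  shows "us ! i \<bullet> us ! j = (if i = j then 1 else 0)"
  using assms by (auto simp: orthonormal_list_def dot_square_norm)

lemma frame_residual_inner:
  assumes "orthonormal_list us" "j \<le> length us" "m < length us"
  shows "frame_residual us j v \<bullet> us ! m = (if m < j then 0 else v \<bullet> us ! m)"
proof -
  have "(\<Sum>l<j. (v \<bullet> us ! l) * (us ! l \<bullet> us ! m)) = (\<Sum>l<j. if l = m then v \<bullet> us ! m else 0)"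
    using assms by (intro sum.cong) (auto simp: orthonormal_inner)
  then show ?thesis
    by (simp add: frame_residual_def inner_diff_left inner_sum_left)
qed

lemma proj_span_take:
  assumes "orthonormal_list us" "j \<le> length us"
  shows "proj (span (set (take j us))) v = (\<Sum>l<j. (v \<bullet> us ! l) *\<^sub>R us ! l)" (is "_ = ?p")
  unfolding proj_def
proof (rule the_equality)
  let ?S = "span (set (take j us))"
  have mem: "us ! l \<in> ?S" if "l < j" for l
    using that assms by (intro span_base) (auto simp: in_set_conv_nth intro!: exI[of _ l])
  then have p: "?p \<in> ?S" by (intro span_sum span_scale) auto
  have orth: "(v - ?p) \<bullet> z = 0" if "z \<in> ?S" for z
    using that
  proof (induction rule: span_induct_alt)
    case (step c y z)
    obtain m where "m < j" "y = us ! m" using step(1) assms by (auto simp: in_set_conv_nth)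
    then have "(v - ?p) \<bullet> y = 0"
      using frame_residual_inner[OF assms, of m v] assms(2) by (simp add: frame_residual_def)
    then show ?case using step by (simp add: inner_add_right)
  qed simp
  show "?p \<in> ?S \<and> (\<forall>z\<in>?S. (v - ?p) \<bullet> z = 0)" using p orth by blast
  fix q assume q: "q \<in> ?S \<and> (\<forall>z\<in>?S. (v - q) \<bullet> z = 0)"
  have "q - ?p \<in> ?S" using p q by (intro span_diff) auto
  then have "(v - ?p) \<bullet> (q - ?p) = 0" "(v - q) \<bullet> (q - ?p) = 0" using q orth by blast+
  then have "(q - ?p) \<bullet> (q - ?p) = 0" by (simp add: inner_diff_left)
  then show "q = ?p" by simp
qed

lemma frenet_residual_eq:
  assumes "orthonormal_list us" "j \<le> length us"
  shows "frenet_residual xs x us j i = frame_residual us j (xs i - x)"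
  unfolding frenet_residual_def frame_residual_def proj_span_take[OF assms] ..

text \<open>The clause \<open>xs i \<noteq> x\<close> is the nonvanishing of the residual at
  \<open>j = 0\<close>, an index that occurs because \<open>us\<close> is nonempty.\<close>

lemma frenet_frame_iff:
  assumes "us \<noteq> []" "orthonormal_list us"
  shows "frenet_frame xs x us \<longleftrightarrow> xs \<longlonglongrightarrow> x \<and> (\<forall>j<length us.
      (\<forall>i. frame_residual us j (xs i - x) \<noteq> 0) \<and>
      (\<lambda>i. (1 / norm (frame_residual us j (xs i - x))) *\<^sub>R frame_residual us j (xs i - x)) \<longlonglongrightarrow> us ! j)"
    (is "_ \<longleftrightarrow> _ \<and> ?R")
proof -
  have "\<forall>i. xs i \<noteq> x" if ?R
    using that assms(1) by (metis frame_residual_0 length_greater_0_conv right_minus_eq)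
  moreover have "?R \<longleftrightarrow> (\<forall>j<length us.
        (\<forall>i. frenet_residual xs x us j i \<noteq> 0) \<and>
        (\<lambda>i. (1 / norm (frenet_residual xs x us j i)) *\<^sub>R frenet_residual xs x us j i)
          \<longlonglongrightarrow> us ! j)"
    using assms(2) by (simp add: frenet_residual_eq)
  ultimately show ?thesis unfolding frenet_frame_def using assms by blast
qed

lemma orthonormal_list_take: "orthonormal_list us \<Longrightarrow> orthonormal_list (take m us)"
  by (simp add: orthonormal_list_def)

lemma frenet_frame_take:
  assumes "frenet_frame xs x us" "0 < m" "m \<le> length us"
  shows "frenet_frame xs x (take m us)"
proof -
  have *: "frame_residual (take m us) j v = frame_residual us j v" if "j < m" for j v
    using that by (simp add: frame_residual_def)
  have o: "orthonormal_list us" "us \<noteq> []" using assms by (simp_all add: frenet_frame_def)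
  have "take m us \<noteq> []" using assms by auto
  then show ?thesis
    using assms by (simp add: frenet_frame_iff o orthonormal_list_take *)
qed

section \<open>Orders of magnitude of the Frenet coordinates\<close>

text \<open>The normalised residual \<open>S\<close> tends to \<open>us ! j\<close>, so its
  component along \<open>us ! j\<close> tends to 1 and its orthogonal part to 0. Up to the factor
  \<open>norm (R i)\<close> these are the \<open>j\<close>-th coordinate and the next residual, and
  the factor cancels in the quotient.\<close>

lemma frenet_frame_asymptotics:
  fixes us :: "'a::euclidean_space list"
  assumes fr: "frenet_frame xs x us" and j: "j < length us"
  shows frenet_coord_pos: "\<forall>\<^sub>F i in sequentially. (xs i - x) \<bullet> us ! j > 0"
    and frenet_residual_small:
      "(\<lambda>i. norm (frame_residual us (Suc j) (xs i - x)) / ((xs i - x) \<bullet> us ! j)) \<longlonglongrightarrow> 0"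
proof -
  have o: "orthonormal_list us" "us \<noteq> []" using assms by (auto simp: frenet_frame_def)
  define R where "R i = frame_residual us j (xs i - x)" for i
  define S where "S i = (1 / norm (R i)) *\<^sub>R R i" for i
  have R: "R i \<noteq> 0" for i
    using fr j unfolding frenet_frame_iff[OF o(2,1)] R_def by blast
  have S: "S \<longlonglongrightarrow> us ! j"
    using fr j unfolding frenet_frame_iff[OF o(2,1)] R_def S_def by blast
  have coord: "R i \<bullet> us ! j = (xs i - x) \<bullet> us ! j" for i
    unfolding R_def using frame_residual_inner[OF o(1), of j j] j by simp
  have S1: "(\<lambda>i. S i \<bullet> us ! j) \<longlonglongrightarrow> 1"
    using tendsto_inner[OF S tendsto_const[of "us ! j"]] orthonormal_inner[OF o(1) j j] by simp
  have Sc: "S i \<bullet> us ! j = ((xs i - x) \<bullet> us ! j) / norm (R i)" for i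
    by (simp add: S_def coord)
  have "\<forall>\<^sub>F i in sequentially. S i \<bullet> us ! j > 0"
    by (rule order_tendstoD(1)[OF S1]) simp
  then show "\<forall>\<^sub>F i in sequentially. (xs i - x) \<bullet> us ! j > 0"
    by eventually_elim (use R in \<open>simp add: Sc zero_less_divide_iff\<close>)
  have "(\<lambda>i. norm (S i - (S i \<bullet> us ! j) *\<^sub>R us ! j) / (S i \<bullet> us ! j)) \<longlonglongrightarrow> norm (us ! j - 1 *\<^sub>R us ! j) / 1"
    by (intro tendsto_intros S S1) simp
  moreover have "norm (S i - (S i \<bullet> us ! j) *\<^sub>R us ! j) / (S i \<bullet> us ! j) =
     norm (frame_residual us (Suc j) (xs i - x)) / ((xs i - x) \<bullet> us ! j)" for i
  proof -
    have "S i - (S i \<bullet> us ! j) *\<^sub>R us ! j = (1 / norm (R i)) *\<^sub>R frame_residual us (Suc j) (xs i - x)"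
      unfolding frame_residual_Suc R_def[symmetric] Sc by (simp add: S_def scaleR_diff_right)
    then show ?thesis using R[of i] unfolding Sc by (simp add: divide_simps)
  qed
  ultimately show "(\<lambda>i. norm (frame_residual us (Suc j) (xs i - x)) / ((xs i - x) \<bullet> us ! j)) \<longlonglongrightarrow> 0"
    by simp
qed

text \<open>The next coordinate is the inner product of the next residual with a unit vector, so
  Cauchy-Schwarz bounds it by the norm of that residual.\<close>

lemma frenet_coord_ratio:
  fixes us :: "'a::euclidean_space list"
  assumes fr: "frenet_frame xs x us" and j: "Suc j < length us"
  shows "(\<lambda>i. ((xs i - x) \<bullet> us ! Suc j) / ((xs i - x) \<bullet> us ! j)) \<longlonglongrightarrow> 0"
proof (rule Lim_null_comparison)
  have o: "orthonormal_list us" using assms by (auto simp: frenet_frame_def)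
  show "(\<lambda>i. norm (frame_residual us (Suc j) (xs i - x)) / ((xs i - x) \<bullet> us ! j)) \<longlonglongrightarrow> 0"
    using j by (intro frenet_residual_small fr) simp
  have "\<forall>\<^sub>F i in sequentially. (xs i - x) \<bullet> us ! j > 0"
    using j by (intro frenet_coord_pos fr) simp
  then show "\<forall>\<^sub>F i in sequentially. norm (((xs i - x) \<bullet> us ! Suc j) / ((xs i - x) \<bullet> us ! j))
      \<le> norm (frame_residual us (Suc j) (xs i - x)) / ((xs i - x) \<bullet> us ! j)"
  proof eventually_elim
    case (elim i)
    have "\<bar>(xs i - x) \<bullet> us ! Suc j\<bar> = \<bar>frame_residual us (Suc j) (xs i - x) \<bullet> us ! Suc j\<bar>"
      using frame_residual_inner[OF o, of "Suc j" "Suc j"] j by simp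
    also have "\<dots> \<le> norm (frame_residual us (Suc j) (xs i - x))"
      using Cauchy_Schwarz_ineq2[of "frame_residual us (Suc j) (xs i - x)" "us ! Suc j"] o j
      by (simp add: orthonormal_list_def)
    finally show ?case using elim by (simp add: divide_right_mono)
  qed
qed

text \<open>The ratios multiply up, so every \<open>a j\<close> with \<open>j > p\<close> is
  negligible against \<open>a p\<close> and only the term at \<open>p\<close> survives the division.
  The coefficient \<open>c p\<close> may be zero; this is how coefficients are later shown to
  vanish.\<close>

lemma leading_term:
  fixes a :: "nat \<Rightarrow> nat \<Rightarrow> real"
  assumes ratio: "\<And>j. Suc j < k \<Longrightarrow> (\<lambda>i. a (Suc j) i / a j i) \<longlonglongrightarrow> 0"
    and pos: "\<And>j. j < k \<Longrightarrow> \<forall>\<^sub>F i in sequentially. a j i > 0"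
    and l: "p < l" "l \<le> k" and c: "\<And>j. j < p \<Longrightarrow> c j = 0"
  shows "(\<lambda>i. (\<Sum>j<l. c j * a j i) / a p i) \<longlonglongrightarrow> c p"
proof -
  have r: "(\<lambda>i. a j i / a p i) \<longlonglongrightarrow> (if j = p then 1 else 0)" if "p \<le> j" "j < k" for j
    using that
  proof (induction j rule: dec_induct)
    case base
    have "\<forall>\<^sub>F i in sequentially. a p i / a p i = 1"
      using pos[OF base] by eventually_elim simp
    then show ?case using tendsto_eventually by auto
  next
    case (step j)
    have "(\<lambda>i. (a (Suc j) i / a j i) * (a j i / a p i)) \<longlonglongrightarrow> 0 * (if j = p then 1 else 0)"
      using step by (intro tendsto_mult ratio) auto
    moreover have "\<forall>\<^sub>F i in sequentially. (a (Suc j) i / a j i) * (a j i / a p i) = a (Suc j) i / a p i"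
      using pos[OF Suc_lessD[OF step.prems]] by eventually_elim simp
    ultimately have "(\<lambda>i. a (Suc j) i / a p i) \<longlonglongrightarrow> 0 * (if j = p then 1 else 0)"
      by (rule Lim_transform_eventually)
    then show ?case using step.hyps by simp
  qed
  have "(\<lambda>i. \<Sum>j<l. c j * (a j i / a p i)) \<longlonglongrightarrow> (\<Sum>j<l. c j * (if j = p then 1 else 0))"
  proof (intro tendsto_sum)
    fix j assume "j \<in> {..<l}"
    then show "(\<lambda>i. c j * (a j i / a p i)) \<longlonglongrightarrow> c j * (if j = p then 1 else 0)"
      using c[of j] tendsto_mult_left[OF r[of j], of "c j"] l by (cases "j < p") auto
  qed
  moreover have "(\<Sum>j<l. c j * (if j = p then 1 else 0)) = c p"
    using l by (simp add: if_distrib cong: if_cong)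
  ultimately show ?thesis by (simp add: sum_divide_distrib)
qed

text \<open>Let \<open>p\<close> be the first index below \<open>l\<close> with
  \<open>c p \<noteq> 0\<close>. The full and the truncated sum have the same leading term
  \<open>c p * a p\<close>, so the sign of the former passes to the latter. Without such an index
  the truncated sum is zero.\<close>

lemma partial_sums_nonpos:
  fixes a :: "nat \<Rightarrow> nat \<Rightarrow> real"
  assumes ratio: "\<And>j. Suc j < k \<Longrightarrow> (\<lambda>i. a (Suc j) i / a j i) \<longlonglongrightarrow> 0"
    and pos: "\<And>j. j < k \<Longrightarrow> \<forall>\<^sub>F i in sequentially. a j i > 0"
    and le: "\<And>i. (\<Sum>j<k. c j * a j i) \<le> 0" and l: "l \<le> k"
  shows "\<forall>\<^sub>F i in sequentially. (\<Sum>j<l. c j * a j i) \<le> 0"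
proof (cases "\<forall>j<l. c j = 0")
  case False
  define p where "p = (LEAST j. j < l \<and> c j \<noteq> 0)"
  have p: "p < l" "c p \<noteq> 0"
    using LeastI_ex[of "\<lambda>j. j < l \<and> c j \<noteq> 0"] False by (auto simp: p_def)
  have z: "c j = 0" if "j < p" for j
    using not_less_Least[of j "\<lambda>j. j < l \<and> c j \<noteq> 0"] that p unfolding p_def by linarith
  have posp: "\<forall>\<^sub>F i in sequentially. a p i > 0" using pos[of p] p l by simp
  have "(\<lambda>i. (\<Sum>j<k. c j * a j i) / a p i) \<longlonglongrightarrow> c p"
    using p l z by (intro leading_term[where k = k and a = a, OF ratio pos]) auto
  moreover have "\<forall>\<^sub>F i in sequentially. (\<Sum>j<k. c j * a j i) / a p i \<le> 0"
    using posp by eventually_elim (simp add: le divide_nonpos_pos)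
  ultimately have "c p \<le> 0" by (intro tendsto_upperbound[of _ _ sequentially]) auto
  moreover have "(\<lambda>i. (\<Sum>j<l. c j * a j i) / a p i) \<longlonglongrightarrow> c p"
    using p l z by (intro leading_term[where k = k and a = a, OF ratio pos]) auto
  ultimately have "\<forall>\<^sub>F i in sequentially. (\<Sum>j<l. c j * a j i) / a p i < 0"
    using p by (intro order_tendstoD(2)[of _ "c p"]) auto
  then show ?thesis using posp
    by eventually_elim (simp add: divide_less_0_iff)
qed simp

lemma orthonormal_list_length:
  fixes us :: "'a::euclidean_space list"
  assumes "orthonormal_list us" shows "length us \<le> DIM('a)"
proof -
  have d: "distinct us"
    unfolding distinct_conv_nth using orthonormal_inner[OF assms] by (metis zero_neq_one)
  have "pairwise orthogonal (set us)"
    unfolding pairwise_def orthogonal_def by (metis in_set_conv_nth orthonormal_inner[OF assms])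
  moreover have "0 \<notin> set us"
    using assms by (fastforce simp: in_set_conv_nth orthonormal_list_def)
  ultimately have "independent (set us)" by (rule pairwise_orthogonal_independent)
  then show ?thesis using independent_bound[of "set us"] distinct_card[OF d] by simp
qed

section \<open>Existence of exhausting Frenet frames\<close>

text \<open>Among the frames realised along subsequences choose a longest one; the dimension bounds
  the length. If its last residual were nonzero infinitely often, compactness of the sphere would
  give one more limit direction, orthogonal to the previous ones. So the residual vanishes from some
  index on, and the earlier terms are dropped.\<close>

lemma frenet_subsequence:
  fixes x :: "'a::euclidean_space"
  assumes lim: "xs \<longlonglongrightarrow> x" and ne: "\<And>i. xs i \<noteq> x"
  obtains \<phi> us where "strict_mono \<phi>" "frenet_frame (xs \<circ> \<phi>) x us"
    "\<And>i. frame_residual us (length us) (xs (\<phi> i) - x) = 0"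
proof -
  define r where "r = (\<lambda>us j i. frame_residual us j (xs i - x))"
  \<comment> \<open>This is the frame condition without convergence and nonemptiness, so that the
    empty list can start the extension.\<close>
  define G where "G = (\<lambda>us \<phi>. strict_mono (\<phi>::nat\<Rightarrow>nat) \<and> orthonormal_list us \<and> (\<forall>j<length us.
      (\<forall>i. r us j (\<phi> i) \<noteq> 0) \<and> (\<lambda>i. (1 / norm (r us j (\<phi> i))) *\<^sub>R r us j (\<phi> i)) \<longlonglongrightarrow> us ! j))"
  have G_sub: "G us (\<phi> \<circ> \<psi>)" if "G us \<phi>" "strict_mono \<psi>" for us \<phi> \<psi>
  proof -
    have "(\<lambda>i. (1 / norm (r us j (\<phi> (\<psi> i)))) *\<^sub>R r us j (\<phi> (\<psi> i))) \<longlonglongrightarrow> us ! j" if "j < length us" for j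
      using LIMSEQ_subseq_LIMSEQ[of "\<lambda>i. (1 / norm (r us j (\<phi> i))) *\<^sub>R r us j (\<phi> i)" "us ! j" \<psi>]
        \<open>G us \<phi>\<close> \<open>strict_mono \<psi>\<close> that by (simp add: G_def o_def)
    then show ?thesis using that by (auto simp: G_def strict_mono_o)
  qed
  have G0: "G [] id" by (auto simp: G_def orthonormal_list_def strict_mono_def)
  define P where "P = (\<lambda>n. \<exists>us \<phi>. length us = n \<and> G us \<phi>)"
  have "P 0" using G0 by (auto simp: P_def)
  moreover have "n \<le> DIM('a)" if "P n" for n
    using that orthonormal_list_length by (auto simp: P_def G_def)
  ultimately obtain k where "P k" and k: "\<And>n. P n \<Longrightarrow> n \<le> k"
    using GreatestI_nat[of P] Greatest_le_nat[of P] by metis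
  then obtain us \<phi> where us: "length us = k" "G us \<phi>" by (auto simp: P_def)
  have on: "orthonormal_list us" and \<phi>: "strict_mono \<phi>" using us by (auto simp: G_def)
  have "finite {i. r us k (\<phi> i) \<noteq> 0}"
  proof (rule ccontr)
    assume inf: "infinite {i. r us k (\<phi> i) \<noteq> 0}"
    then obtain \<psi> :: "nat \<Rightarrow> nat" where psi: "strict_mono \<psi>" "\<And>i. r us k (\<phi> (\<psi> i)) \<noteq> 0"
      using infinite_enumerate[OF inf] by auto
    define S where "S i = (1 / norm (r us k (\<phi> (\<psi> i)))) *\<^sub>R r us k (\<phi> (\<psi> i))" for i
    have "S i \<in> sphere 0 1" for i using psi(2)[of i] by (simp add: S_def)
    then obtain u \<rho> where u: "u \<in> sphere 0 1" "strict_mono \<rho>" "(S \<circ> \<rho>) \<longlonglongrightarrow> u"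
      using compact_sphere[of 0 1] unfolding compact_def by metis
    define \<theta> where "\<theta> = \<phi> \<circ> (\<psi> \<circ> \<rho>)"
    have G\<theta>: "G us \<theta>" unfolding \<theta>_def by (intro G_sub us strict_mono_o psi u)
    have orth: "u \<bullet> us ! j = 0" if "j < k" for j
    proof -
      have "(\<lambda>i. (S \<circ> \<rho>) i \<bullet> us ! j) \<longlonglongrightarrow> u \<bullet> us ! j" by (intro tendsto_intros u)
      moreover have "(S \<circ> \<rho>) i \<bullet> us ! j = 0" for i
        using frame_residual_inner[OF on, of k j] that us(1) by (simp add: S_def r_def)
      ultimately show ?thesis by (simp add: LIMSEQ_const_iff)
    qed
    have "orthonormal_list (us @ [u])"
      using on u(1) orth us(1) unfolding orthonormal_list_def
      by (auto simp: nth_append less_Suc_eq inner_commute)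
    moreover have "r (us @ [u]) j i = r us j i" if "j \<le> k" for j i
      using frame_residual_append[of j us] that us(1) by (simp add: r_def)
    moreover have "(\<lambda>i. (1 / norm (r us k (\<theta> i))) *\<^sub>R r us k (\<theta> i)) \<longlonglongrightarrow> u"
      using u(3) by (simp add: S_def \<theta>_def o_def)
    ultimately have "G (us @ [u]) \<theta>"
      using G\<theta> psi(2) us(1) unfolding G_def by (auto simp: less_Suc_eq nth_append \<theta>_def)
    then have "P (Suc k)" unfolding P_def using us(1) by (intro exI[of _ "us @ [u]"]) auto
    then show False using k by fastforce
  qed
  then obtain N where N: "\<And>i. i \<ge> N \<Longrightarrow> r us k (\<phi> i) = 0"
    unfolding finite_nat_set_iff_bounded by (metis (mono_tags, lifting) mem_Collect_eq not_le)
  have sm: "strict_mono (\<lambda>i. i + N)" by (simp add: strict_mono_def)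
  have G': "G us (\<phi> \<circ> (\<lambda>i. i + N))" by (rule G_sub[OF us(2) sm])
  have "us \<noteq> []"
  proof
    assume "us = []"
    then have "xs (\<phi> N) - x = 0" using N[of N] us(1) by (simp add: r_def)
    then show False using ne by simp
  qed
  show ?thesis
  proof
    show s: "strict_mono (\<phi> \<circ> (\<lambda>i. i + N))" using G' by (simp add: G_def)
    show "frenet_frame (xs \<circ> (\<phi> \<circ> (\<lambda>i. i + N))) x us"
      unfolding frenet_frame_iff[OF \<open>us \<noteq> []\<close> on]
      using LIMSEQ_subseq_LIMSEQ[OF lim s] G' by (simp add: G_def r_def)
    show "frame_residual us (length us) (xs ((\<phi> \<circ> (\<lambda>i. i + N)) i) - x) = 0" for i
      using N[of "i + N"] us(1) by (simp add: r_def)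
  qed
qed

subsection \<open>Outgoing tangents\<close>

lemma pwl_inner_diff: "pwl (\<lambda>y. (y - x) \<bullet> c)"
proof -
  have "(y - x) \<bullet> c = c \<bullet> y + - (x \<bullet> c)" for y by (simp add: inner_diff_left inner_commute[of c])
  then show ?thesis by (simp only:) (rule pwl_inner)
qed

text \<open>Decreasing weights between 0 and 1 are the tail sums of barycentric coordinates in the
  simplex. The induction splits off the last vertex with the last weight and rescales the
  others.\<close>

lemma frame_vertex_combination:
  assumes "convex S" "\<And>m. m \<le> k \<Longrightarrow> frame_vertex x lam us m \<in> S"
    and "\<And>j. j < k \<Longrightarrow> 0 \<le> s j \<and> s j \<le> 1" "\<And>i j. i \<le> j \<Longrightarrow> j < k \<Longrightarrow> s j \<le> s i"
  shows "x + (\<Sum>j<k. (s j * lam j) *\<^sub>R us ! j) \<in> S"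
  using assms(2-)
proof (induction k arbitrary: s)
  case 0
  then show ?case using "0.prems"(1)[of 0] by (simp add: frame_vertex_def)
next
  case (Suc k)
  \<comment> \<open>\<open>\<sigma>\<close> is the barycentric coordinate of the last vertex, and
    \<open>s'\<close> below normalises the remaining mass \<open>1 - \<sigma>\<close>. If
    \<open>\<sigma> = 1\<close>, all weights are 1 and the point is that vertex.\<close>
  define \<sigma> where "\<sigma> = s k"
  have \<sigma>: "0 \<le> \<sigma>" "\<sigma> \<le> 1" "\<And>j. j < k \<Longrightarrow> \<sigma> \<le> s j"
    using Suc.prems(2)[of k] Suc.prems(3)[of _ k] by (auto simp: \<sigma>_def)
  show ?case
  proof (cases "\<sigma> = 1")
    case True
    then have "s j = 1" if "j < Suc k" for j
      using \<sigma>(3)[of j] Suc.prems(2)[of j] that by (cases "j = k") (auto simp: \<sigma>_def)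
    then show ?thesis using Suc.prems(1)[of "Suc k"] by (simp add: frame_vertex_def)
  next
    case False
    then have \<sigma>1: "1 - \<sigma> > 0" using \<sigma> by simp
    define s' where "s' j = (s j - \<sigma>) / (1 - \<sigma>)" for j
    have s': "s j = \<sigma> + (1 - \<sigma>) * s' j" for j using \<sigma>1 by (simp add: s'_def)
    have "x + (\<Sum>j<k. (s' j * lam j) *\<^sub>R us ! j) \<in> S" (is "?z \<in> S")
    proof (rule Suc.IH)
      show "0 \<le> s' j \<and> s' j \<le> 1" if "j < k" for j
        using Suc.prems(2)[of j] \<sigma>(3)[OF that] \<sigma>1 that by (simp add: s'_def divide_simps)
      show "s' j \<le> s' i" if "i \<le> j" "j < k" for i j
        using Suc.prems(3)[of i j] \<sigma>1 that by (simp add: s'_def divide_right_mono)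
    qed (use Suc.prems in auto)
    then have "\<sigma> *\<^sub>R frame_vertex x lam us (Suc k) + (1 - \<sigma>) *\<^sub>R ?z \<in> S"
      using \<sigma> Suc.prems(1)[of "Suc k"] by (intro convexD[OF assms(1)]) auto
    moreover have "\<sigma> *\<^sub>R frame_vertex x lam us (Suc k) + (1 - \<sigma>) *\<^sub>R ?z
       = x + (\<Sum>j<k. (s j * lam j) *\<^sub>R us ! j) + (\<sigma> * lam k) *\<^sub>R us ! k"
      by (simp add: s' frame_vertex_def algebra_simps scaleR_sum_right sum.distrib sum_subtractf)
    ultimately show ?thesis by (simp add: \<sigma>_def add.assoc)
  qed
qed

lemma outgoing_tangent_imp_unbounded_ratio:
  fixes X :: "'a::euclidean_space set"
  assumes "bounded X" and out: "outgoing_tangent X x us"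
  shows "\<exists>f\<in>RX X. \<exists>g\<in>RX X. (\<forall>y\<in>X. g y = 0 \<longrightarrow> f y = 0) \<and>
           (\<forall>m::nat. \<exists>y\<in>X. \<bar>f y\<bar> > real m * \<bar>g y\<bar>)"
proof -
  obtain lam xs where lam: "\<And>j. j < length us \<Longrightarrow> lam j > 0"
    and C: "convex hull {frame_vertex x lam us m | m. m \<le> length us} \<inter> X =
       convex hull {frame_vertex x lam us m | m. m < length us} \<inter> X"
    and xs: "\<And>i. xs i \<in> X" and fr: "frenet_frame xs x us"
    using out unfolding outgoing_tangent_def tangent_def Let_def by blast
  have on: "orthonormal_list us" and "us \<noteq> []" using fr by (simp_all add: frenet_frame_def)
  then obtain n where n: "length us = Suc n" by (cases us) auto
  txt \<open>The zero set of \<open>g0\<close> is the simplex \<open>C\<close>, while \<open>f0\<close> vanishes on its facet \<open>C'\<close>. Along the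
    sequence \<open>g0\<close> only sees the residual, which is negligible against the last coordinate \<open>f0\<close>.\<close>
  define t where "t j y = (y - x) \<bullet> us ! j" for j y
  define R where "R y = frame_residual us (length us) (y - x)" for y
  define f0 where "f0 y = t n y" for y
  \<comment> \<open>In terms of the weights \<open>t j y / lam j\<close>, the summands penalise in
    turn a nonzero residual, a first weight above 1, an increase between consecutive weights, and a
    negative last weight.\<close>
  define g0 where "g0 y = (\<Sum>b\<in>Basis. \<bar>(y - x) \<bullet> frame_residual us (length us) b\<bar>) +
     max 0 (1 / lam 0 * t 0 y + - 1) +
     (\<Sum>j<n. max 0 (1 / lam (Suc j) * t (Suc j) y + - 1 / lam j * t j y)) +
     max 0 (- 1 / lam n * t n y)" for y
  define f where "f y = (if y \<in> X then f0 y else 0)" for y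
  define g where "g y = (if y \<in> X then g0 y else 0)" for y
  have pt: "pwl (t j)" for j unfolding t_def by (rule pwl_inner_diff)
  have "pwl g0"
    unfolding g0_def
    by (intro pwl_add pwl_sum pwl_abs pwl_max pwl_const pwl_scale pt pwl_inner_diff)
  then have gR: "g \<in> RX X" by (rule RX_I[OF assms(1)]) (simp_all add: g_def)
  have "pwl f0" unfolding f0_def by (rule pt)
  then have fR: "f \<in> RX X" by (rule RX_I[OF assms(1)]) (simp_all add: f_def)
  have zero: "f y = 0" if y: "y \<in> X" and "g y = 0" for y
  proof -
    have g0: "g0 y = 0" using that by (simp add: g_def)
    have nn: "(\<Sum>b\<in>Basis. \<bar>(y - x) \<bullet> frame_residual us (length us) b\<bar>) \<ge> 0"
      "max 0 (1 / lam 0 * t 0 y + - 1) \<ge> 0"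
      "(\<Sum>j<n. max 0 (1 / lam (Suc j) * t (Suc j) y + - 1 / lam j * t j y)) \<ge> 0"
      "max 0 (- 1 / lam n * t n y) \<ge> 0"
      by (simp_all add: sum_nonneg)
    have 1: "(\<Sum>b\<in>Basis. \<bar>(y - x) \<bullet> frame_residual us (length us) b\<bar>) = 0"
      and 2: "max 0 (1 / lam 0 * t 0 y + - 1) = 0"
      and 3: "(\<Sum>j<n. max 0 (1 / lam (Suc j) * t (Suc j) y + - 1 / lam j * t j y)) = 0"
      and 4: "max 0 (- 1 / lam n * t n y) = 0"
      using g0 nn unfolding g0_def by linarith+
    define s where "s j = t j y / lam j" for j
    have step: "s (Suc j) \<le> s j" if "j < n" for j
    proof -
      have "max 0 (1 / lam (Suc j) * t (Suc j) y + - 1 / lam j * t j y) = 0"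
        using 3 that by (subst (asm) sum_nonneg_eq_0_iff) auto
      then show ?thesis by (simp add: s_def max_def split: if_splits)
    qed
    have s0: "s 0 \<le> 1" and sn: "0 \<le> s n"
      using 2 4 by (auto simp: s_def max_def split: if_splits)
    have anti: "s j \<le> s i" if "i \<le> j" "j < Suc n" for i j
      using that
    proof (induction j rule: dec_induct)
      case (step j)
      then show ?case using \<open>\<And>j. j < n \<Longrightarrow> s (Suc j) \<le> s j\<close>[of j] by simp
    qed simp
    have "R y = 0"
    proof (rule euclidean_eqI)
      fix b :: 'a assume "b \<in> Basis"
      then have "\<bar>(y - x) \<bullet> frame_residual us (length us) b\<bar> = 0"
        using 1 by (subst (asm) sum_nonneg_eq_0_iff) auto
      then show "R y \<bullet> b = 0 \<bullet> b" by (simp add: R_def frame_residual_selfadjoint)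
    qed
    then have "y = x + (\<Sum>j<Suc n. t j y *\<^sub>R us ! j)"
      by (simp add: R_def frame_residual_def n t_def algebra_simps)
    also have "(\<Sum>j<Suc n. t j y *\<^sub>R us ! j) = (\<Sum>j<Suc n. (s j * lam j) *\<^sub>R us ! j)"
    proof (rule sum.cong)
      fix j assume "j \<in> {..<Suc n}"
      then have "lam j \<noteq> 0" using lam[of j] n by simp
      then show "t j y *\<^sub>R us ! j = (s j * lam j) *\<^sub>R us ! j" by (simp add: s_def)
    qed simp
    also have "x + (\<Sum>j<Suc n. (s j * lam j) *\<^sub>R us ! j)
        \<in> convex hull {frame_vertex x lam us m | m. m \<le> length us}"
    proof (rule frame_vertex_combination[OF convex_convex_hull])
      show "frame_vertex x lam us m \<in> convex hull {frame_vertex x lam us m | m. m \<le> length us}"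
        if "m \<le> Suc n" for m using that n by (intro hull_inc) auto
      show "0 \<le> s j \<and> s j \<le> 1" if "j < Suc n" for j
        using that anti[of 0 j] anti[of j n] s0 sn by auto
    qed (rule anti)
    \<comment> \<open>The outgoing condition moves \<open>y\<close> from the simplex to its
      facet.\<close>
    finally have "y \<in> convex hull {frame_vertex x lam us m | m. m < length us}"
      using C y by blast
    moreover have "convex hull {frame_vertex x lam us m | m. m < length us} \<subseteq>
        {z. us ! n \<bullet> z = us ! n \<bullet> x}"
    proof (rule hull_minimal)
      have "us ! n \<bullet> us ! j = 0" if "j < n" for j
        using that n orthonormal_inner[OF on, of n j] by simp
      then show "{frame_vertex x lam us m | m. m < length us} \<subseteq> {z. us ! n \<bullet> z = us ! n \<bullet> x}"
        by (auto simp: frame_vertex_def inner_add_right inner_sum_right n intro!: sum.neutral)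
    qed (rule convex_hyperplane)
    ultimately show ?thesis
      using y by (auto simp: f_def f0_def t_def inner_diff_left inner_commute)
  qed
  \<comment> \<open>Along the sequence all truncated terms of \<open>g0\<close> eventually vanish:
    the first coordinate and the consecutive ratios tend to zero, and the last coordinate is
    positive.\<close>
  have pos: "\<forall>\<^sub>F i in sequentially. t j (xs i) > 0" if "j < Suc n" for j
    unfolding t_def using frenet_coord_pos[OF fr] that n by simp
  have lim: "(\<lambda>i. xs i) \<longlonglongrightarrow> x" using fr by (simp add: frenet_frame_def)
  have "(\<lambda>i. t 0 (xs i)) \<longlonglongrightarrow> (x - x) \<bullet> us ! 0" unfolding t_def by (intro tendsto_intros lim)
  then have "\<forall>\<^sub>F i in sequentially. t 0 (xs i) < lam 0"
    by (rule order_tendstoD(2)) (simp add: lam n)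
  then have ev2: "\<forall>\<^sub>F i in sequentially. max 0 (1 / lam 0 * t 0 (xs i) + - 1) = 0"
    by eventually_elim (simp add: lam n max_def divide_simps)
  have ev3: "\<forall>\<^sub>F i in sequentially. \<forall>j\<in>{..<n}.
      max 0 (1 / lam (Suc j) * t (Suc j) (xs i) + - 1 / lam j * t j (xs i)) = 0"
  proof (intro eventually_ball_finite ballI)
    fix j assume "j \<in> {..<n}"
    then have j: "j < n" by simp
    then have l: "lam j > 0" "lam (Suc j) > 0" using lam n by simp_all
    have "(\<lambda>i. t (Suc j) (xs i) / t j (xs i)) \<longlonglongrightarrow> 0"
      unfolding t_def using j n by (intro frenet_coord_ratio[OF fr]) simp
    then have "\<forall>\<^sub>F i in sequentially. t (Suc j) (xs i) / t j (xs i) < lam (Suc j) / lam j"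
      using l by (intro order_tendstoD(2)) auto
    then show "\<forall>\<^sub>F i in sequentially. max 0 (1 / lam (Suc j) * t (Suc j) (xs i) + - 1 / lam j * t j (xs i)) = 0"
      using pos[OF less_SucI[OF j]]
    proof eventually_elim
      case (elim i)
      then show ?case using l by (simp add: max_def field_simps)
    qed
  qed simp
  have small: "(\<lambda>i. norm (R (xs i)) / t n (xs i)) \<longlonglongrightarrow> 0"
    unfolding R_def t_def using frenet_residual_small[OF fr, of n] n by simp
  have big: "\<exists>y\<in>X. \<bar>f y\<bar> > real m * \<bar>g y\<bar>" for m :: nat
  proof -
    \<comment> \<open>The factor \<open>DIM('a)\<close> comes from bounding the sum of absolute
      coordinates by the norm; the added 1 keeps \<open>D\<close> positive for
      \<open>m = 0\<close>.\<close>
    define D where "D = real m * real DIM('a) + 1"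
    have D: "D > 0" by (simp add: D_def add_nonneg_pos)
    have "\<forall>\<^sub>F i in sequentially. norm (R (xs i)) / t n (xs i) < 1 / D"
      using D by (intro order_tendstoD(2)[OF small]) simp
    then have "\<forall>\<^sub>F i in sequentially. \<bar>f (xs i)\<bar> > real m * \<bar>g (xs i)\<bar>"
      using ev2 ev3 pos[OF lessI]
    proof eventually_elim
      case (elim i)
      have "t n (xs i) / lam n > 0" using elim(4) lam[of n] n by simp
      then have g_eq: "g (xs i) = (\<Sum>b\<in>Basis. \<bar>R (xs i) \<bullet> b\<bar>)"
        using elim xs by (simp add: g_def g0_def R_def frame_residual_selfadjoint)
      also have "\<dots> \<le> real DIM('a) * norm (R (xs i))"
        by (rule sum_bounded_above) (simp add: Basis_le_norm)
      finally have "real m * g (xs i) \<le> real m * (real DIM('a) * norm (R (xs i)))"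
        by (intro mult_left_mono) auto
      also have "\<dots> \<le> D * norm (R (xs i))" by (simp add: D_def algebra_simps)
      also have "\<dots> < t n (xs i)" using elim(1,4) D by (simp add: field_simps)
      finally show ?case
        using g_eq elim(4) xs by (simp add: f_def f0_def sum_nonneg)
    qed
    then obtain i where "\<bar>f (xs i)\<bar> > real m * \<bar>g (xs i)\<bar>"
      using eventually_happens trivial_limit_sequentially by blast
    then show ?thesis using xs by blast
  qed
  show ?thesis
    by (rule bexI[OF bexI[OF conjI gR] fR]) (use zero big in auto)
qed

section \<open>From an unbounded ratio to an outgoing tangent\<close>

text \<open>The value of \<open>\<alpha>\<close> is \<open>e\<close> on the hull of \<open>S\<close>
  but not at \<open>v\<close>, so a point on the hyperplane can give \<open>v\<close> no weight.
  This will cut the simplex down to its facet.\<close>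

lemma convex_hull_insert_hyperplane:
  fixes \<alpha> :: "'a::euclidean_space"
  assumes "y \<in> convex hull (insert v S)" "S \<noteq> {}"
    and S: "\<And>z. z \<in> S \<Longrightarrow> \<alpha> \<bullet> z = e" and "\<alpha> \<bullet> v \<noteq> e" "\<alpha> \<bullet> y = e"
  shows "y \<in> convex hull S"
proof -
  obtain p q b where pq: "p \<ge> 0" "q \<ge> 0" "p + q = 1" "b \<in> convex hull S" "y = p *\<^sub>R v + q *\<^sub>R b"
    using assms(1) unfolding convex_hull_insert[OF assms(2)] by blast
  have "convex hull S \<subseteq> {z. \<alpha> \<bullet> z = e}"
    using S by (intro hull_minimal convex_hyperplane) auto
  then have "\<alpha> \<bullet> b = e" using pq by blast
  then have "p * (\<alpha> \<bullet> v) + q * e = (p + q) * e"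
    using assms(5) pq by (simp add: inner_add_right)
  then have "p = 0" using assms(4) by (simp add: distrib_right)
  then show ?thesis using pq by simp
qed

text \<open>Returns to the triangulation, because the limit arguments need convex cells on which
  \<open>f\<close> is affine, and \<open>pwl\<close> does not display them.\<close>

lemma RX_cells:
  fixes X :: "'a::euclidean_space set"
  assumes "f \<in> RX X"
  obtains \<T> where "finite \<T>" "\<And>T. T \<in> \<T> \<Longrightarrow> polyhedron T" "X \<subseteq> \<Union>\<T>"
    "\<And>T. T \<in> \<T> \<Longrightarrow> \<exists>p. \<forall>y\<in>T \<inter> X. f y = aff p y"
proof -
  obtain K g where K: "X \<subseteq> K" "pl_on K g" "f = (\<lambda>y. if y \<in> X then g y else 0)"
    using assms unfolding RX_def by blast
  obtain \<T> where T: "triangulation \<T>" "\<Union>\<T> = K" "\<And>T. T \<in> \<T> \<Longrightarrow> \<exists>c d. \<forall>y\<in>T. g y = c \<bullet> y + d"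
    using K(2) unfolding pl_on_def by blast
  show ?thesis
  proof (rule that[of \<T>])
    show "finite \<T>" using T(1) by (simp add: triangulation_def)
    show "polyhedron T" if "T \<in> \<T>" for T
      using T(1) that polytope_imp_polyhedron simplex_imp_polytope unfolding triangulation_def by blast
    show "X \<subseteq> \<Union>\<T>" using K T by simp
    show "\<exists>p. \<forall>y\<in>T \<inter> X. f y = aff p y" if TT: "T \<in> \<T>" for T
    proof -
      obtain c d where "\<forall>y\<in>T. g y = c \<bullet> y + d" using T(3)[OF TT] by blast
      then show ?thesis using K(3) by (intro exI[of _ "(c, d)"]) (simp add: aff_def)
    qed
  qed
qed

lemma limit_zero_of_dominated:
  fixes F G :: "nat \<Rightarrow> real"
  assumes "F \<longlonglongrightarrow> c" "G \<longlonglongrightarrow> d" and le: "\<forall>\<^sub>F i in sequentially. real i * \<bar>G i\<bar> \<le> \<bar>F i\<bar>"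
  shows "d = 0"
proof -
  have "(\<lambda>i. \<bar>F i\<bar> * inverse (real i)) \<longlonglongrightarrow> \<bar>c\<bar> * 0"
    by (intro tendsto_intros assms lim_inverse_n)
  moreover have "\<forall>\<^sub>F i in sequentially. norm (G i) \<le> \<bar>F i\<bar> * inverse (real i)"
    using le eventually_gt_at_top[of 0] by eventually_elim (simp add: field_simps)
  ultimately have "G \<longlonglongrightarrow> 0" using Lim_null_comparison by (metis mult_zero_right)
  then show ?thesis using assms(2) LIMSEQ_unique by blast
qed

text \<open>Each of the finitely many defining inequalities is treated separately. If it is strict
  at \<open>x\<close>, it persists nearby; if it is tight, it concerns the sign of a sum of the
  \<open>a j\<close>, and truncation eventually preserves that sign.\<close>

lemma partial_sums_in_polyhedron:
  fixes T :: "'a::euclidean_space set"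
  assumes "polyhedron T" "x \<in> T"
    and ratio: "\<And>j. Suc j < k \<Longrightarrow> (\<lambda>i. a (Suc j) i / a j i) \<longlonglongrightarrow> (0::real)"
    and pos: "\<And>j. j < k \<Longrightarrow> \<forall>\<^sub>F i in sequentially. a j i > 0"
    and null: "\<And>j. j < k \<Longrightarrow> a j \<longlonglongrightarrow> 0"
    and mem: "\<And>i. x + (\<Sum>j<k. a j i *\<^sub>R u j) \<in> T" and l: "l \<le> k"
  shows "\<forall>\<^sub>F i in sequentially. x + (\<Sum>j<l. a j i *\<^sub>R u j) \<in> T"
proof -
  obtain F where F: "finite F" "T = \<Inter>F" "\<And>h. h \<in> F \<Longrightarrow> \<exists>b e. h = {y. b \<bullet> y \<le> e}"
    using assms(1) unfolding polyhedron_def by metis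
  have "\<forall>\<^sub>F i in sequentially. \<forall>h\<in>F. x + (\<Sum>j<l. a j i *\<^sub>R u j) \<in> h"
  proof (intro eventually_ball_finite F ballI)
    fix h assume h: "h \<in> F"
    then obtain b e where be: "h = {y. b \<bullet> y \<le> e}" using F by blast
    have "b \<bullet> x \<le> e" using h be F(2) assms(2) by blast
    then consider "b \<bullet> x < e" | "b \<bullet> x = e" by linarith
    then show "\<forall>\<^sub>F i in sequentially. x + (\<Sum>j<l. a j i *\<^sub>R u j) \<in> h"
    proof cases
      case 1
      have "(\<lambda>i. b \<bullet> (x + (\<Sum>j<l. a j i *\<^sub>R u j))) \<longlonglongrightarrow> b \<bullet> (x + (\<Sum>j<l. 0 *\<^sub>R u j))"
        using l by (intro tendsto_intros null) auto
      then have "\<forall>\<^sub>F i in sequentially. b \<bullet> (x + (\<Sum>j<l. a j i *\<^sub>R u j)) < e"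
        using 1 by (intro order_tendstoD(2)) auto
      then show ?thesis by eventually_elim (simp add: be)
    next
      case 2
      have "\<forall>\<^sub>F i in sequentially. (\<Sum>j<l. (b \<bullet> u j) * a j i) \<le> 0"
      proof (rule partial_sums_nonpos[where k = k and a = a, OF ratio pos _ l])
        show "(\<Sum>j<k. (b \<bullet> u j) * a j i) \<le> 0" for i
        proof -
          have "x + (\<Sum>j<k. a j i *\<^sub>R u j) \<in> h" using mem[of i] h F(2) by blast
          then show ?thesis
            by (simp add: be 2 inner_add_right inner_sum_right mult.commute)
        qed
      qed
      then show ?thesis
        by eventually_elim (simp add: be 2 inner_add_right inner_sum_right mult.commute)
    qed
  qed
  then show ?thesis by (simp add: F(2))
qed

text \<open>Some pair of cells, one for \<open>f\<close> and one for \<open>g\<close>, contains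
  infinitely many of the chosen points; \<open>T\<close> is the intersection of the pair.
  Compactness then gives the limit.\<close>

lemma unbounded_ratio_imp_convergent_sequence:
  fixes X :: "'a::euclidean_space set"
  assumes "compact X" and f: "f \<in> RX X" and g: "g \<in> RX X"
    and unb: "\<And>m::nat. \<exists>y\<in>X. \<bar>f y\<bar> > real m * \<bar>g y\<bar>"
  obtains T p q xs x where "polyhedron T" "\<And>y. y \<in> T \<inter> X \<Longrightarrow> f y = aff p y"
    "\<And>y. y \<in> T \<inter> X \<Longrightarrow> g y = aff q y" "\<And>i. xs i \<in> T \<inter> X" "x \<in> T \<inter> X" "xs \<longlonglongrightarrow> x"
    "\<And>i. \<bar>f (xs i)\<bar> > real i * \<bar>g (xs i)\<bar>" "g x = 0"
proof -
  obtain \<T>1 where T1: "finite \<T>1" "\<And>T. T \<in> \<T>1 \<Longrightarrow> polyhedron T" "X \<subseteq> \<Union>\<T>1"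
    "\<And>T. T \<in> \<T>1 \<Longrightarrow> \<exists>p. \<forall>y\<in>T \<inter> X. f y = aff p y" using RX_cells[OF f] by metis
  obtain \<T>2 where T2: "finite \<T>2" "\<And>T. T \<in> \<T>2 \<Longrightarrow> polyhedron T" "X \<subseteq> \<Union>\<T>2"
    "\<And>T. T \<in> \<T>2 \<Longrightarrow> \<exists>p. \<forall>y\<in>T \<inter> X. g y = aff p y" using RX_cells[OF g] by metis
  have "\<forall>m::nat. \<exists>y. y \<in> X \<and> \<bar>f y\<bar> > real m * \<bar>g y\<bar>" using unb by blast
  then obtain ys where "\<forall>m::nat. ys m \<in> X \<and> \<bar>f (ys m)\<bar> > real m * \<bar>g (ys m)\<bar>"
    by (rule choice[THEN exE])
  then have ys: "\<And>m. ys m \<in> X" "\<And>m. \<bar>f (ys m)\<bar> > real m * \<bar>g (ys m)\<bar>" by auto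
  have "\<forall>m. \<exists>T. T \<in> \<T>1 \<and> ys m \<in> T" using ys(1) T1(3) by blast
  then obtain c where c1: "\<forall>m. c m \<in> \<T>1 \<and> ys m \<in> c m" by (rule choice[THEN exE])
  have "\<forall>m. \<exists>T. T \<in> \<T>2 \<and> ys m \<in> T" using ys(1) T2(3) by blast
  then obtain c' where c2: "\<forall>m. c' m \<in> \<T>2 \<and> ys m \<in> c' m" by (rule choice[THEN exE])
  have c: "\<And>m. c m \<in> \<T>1" "\<And>m. c' m \<in> \<T>2" "\<And>m. ys m \<in> c m \<inter> c' m" using c1 c2 by auto
  define h where "h m = (c m, c' m)" for m
  have "finite (range h)"
    using T1(1) T2(1) c by (intro finite_subset[of "range h" "\<T>1 \<times> \<T>2"]) (auto simp: h_def)
  then obtain m0 where "infinite {m. h m = h m0}"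
    using pigeonhole_infinite[OF infinite_UNIV_nat, of h] by auto
  from infinite_enumerate[OF this]
  obtain \<psi> :: "nat \<Rightarrow> nat" where psi: "strict_mono \<psi>" "\<And>i. h (\<psi> i) = h m0" by auto
  obtain x \<rho> where x: "x \<in> X" "strict_mono \<rho>" "((ys \<circ> \<psi>) \<circ> \<rho>) \<longlonglongrightarrow> x"
    using assms(1) ys(1) unfolding compact_def by (metis comp_apply)
  define xs where "xs = (ys \<circ> \<psi>) \<circ> \<rho>"
  define T where "T = c m0 \<inter> c' m0"
  have sm: "strict_mono (\<psi> \<circ> \<rho>)" by (intro strict_mono_o psi x)
  have T: "polyhedron T" unfolding T_def by (intro polyhedron_Int T1 T2 c)
  have xsT: "xs i \<in> T \<inter> X" for i
    using c(3)[of "\<psi> (\<rho> i)"] psi(2)[of "\<rho> i"] ys(1) by (simp add: xs_def T_def h_def)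
  have lim: "xs \<longlonglongrightarrow> x" using x(3) by (simp add: xs_def)
  have xT: "x \<in> T"
    using closed_sequentially[OF polyhedron_imp_closed[OF T] _ lim] xsT by blast
  \<comment> \<open>Passing to a subsequence only increases the indices, so the inequality survives
    with the new index \<open>i\<close>.\<close>
  have big: "\<bar>f (xs i)\<bar> > real i * \<bar>g (xs i)\<bar>" for i
  proof -
    have "real i * \<bar>g (xs i)\<bar> \<le> real (\<psi> (\<rho> i)) * \<bar>g (xs i)\<bar>"
      using seq_suble[OF sm, of i] by (intro mult_right_mono) auto
    also have "\<dots> < \<bar>f (xs i)\<bar>" using ys(2)[of "\<psi> (\<rho> i)"] by (simp add: xs_def)
    finally show ?thesis .
  qed
  have bX: "bounded X" by (rule compact_imp_bounded[OF assms(1)])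
  have conv: "(\<lambda>i. h (xs i)) \<longlonglongrightarrow> h x" if "h \<in> RX X" for h
    by (rule continuous_on_tendsto_compose[OF RX_continuous[OF bX that] lim x(1)]) (use xsT in auto)
  have "g x = 0"
    by (rule limit_zero_of_dominated[OF conv[OF f] conv[OF g]]) (simp add: big less_imp_le)
  obtain p where p: "\<forall>y\<in>c m0 \<inter> X. f y = aff p y" using T1(4)[OF c(1)] by blast
  obtain q where q: "\<forall>y\<in>c' m0 \<inter> X. g y = aff q y" using T2(4)[OF c(2)] by blast
  show ?thesis
    by (rule that[of T p q xs x]) (use T p q xsT xT x(1) lim big \<open>g x = 0\<close> in \<open>auto simp: T_def\<close>)
qed

lemma unbounded_ratio_imp_outgoing_tangent:
  fixes X :: "'a::euclidean_space set"
  assumes "compact X" and f: "f \<in> RX X" and g: "g \<in> RX X"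
    and zero: "\<And>y. y \<in> X \<Longrightarrow> g y = 0 \<Longrightarrow> f y = 0"
    and unb: "\<And>m::nat. \<exists>y\<in>X. \<bar>f y\<bar> > real m * \<bar>g y\<bar>"
  shows "\<exists>x\<in>X. \<exists>us. outgoing_tangent X x us"
proof -
  obtain T p q xs x where T: "polyhedron T" and fT: "\<And>y. y \<in> T \<inter> X \<Longrightarrow> f y = aff p y"
    and gT: "\<And>y. y \<in> T \<inter> X \<Longrightarrow> g y = aff q y" and xs: "\<And>i. xs i \<in> T \<inter> X" "xs \<longlonglongrightarrow> x"
    and x: "x \<in> T \<inter> X" and big: "\<And>i. \<bar>f (xs i)\<bar> > real i * \<bar>g (xs i)\<bar>" and gx: "g x = 0"
    using unbounded_ratio_imp_convergent_sequence[OF assms(1) f g unb] by metis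
  have fx: "f x = 0" using zero gx x by blast
  define \<alpha> where "\<alpha> = fst p"
  define \<beta> where "\<beta> = fst q"
  have f_eq: "f y = \<alpha> \<bullet> (y - x)" if "y \<in> T \<inter> X" for y
    using fT[OF that] fT[OF x] fx by (simp add: aff_def \<alpha>_def inner_diff_right)
  have g_eq: "g y = \<beta> \<bullet> (y - x)" if "y \<in> T \<inter> X" for y
    using gT[OF that] gT[OF x] gx by (simp add: aff_def \<beta>_def inner_diff_right)
  have "xs i \<noteq> x" for i using big[of i] fx gx by auto
  then obtain \<phi> us where \<phi>: "strict_mono \<phi>" and fr: "frenet_frame (xs \<circ> \<phi>) x us"
    and res: "\<And>i. frame_residual us (length us) (xs (\<phi> i) - x) = 0"
    using frenet_subsequence[OF xs(2)] by metis
  define zs where "zs = xs \<circ> \<phi>"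
  define k where "k = length us"
  define a where "a j i = (zs i - x) \<bullet> us ! j" for j i
  have zsT: "zs i \<in> T \<inter> X" for i using xs by (simp add: zs_def)
  have fz: "frenet_frame zs x us" using fr by (simp add: zs_def)
  have lim: "zs \<longlonglongrightarrow> x" and on: "orthonormal_list us" using fz by (simp_all add: frenet_frame_def)
  have bigz: "\<bar>f (zs i)\<bar> > real i * \<bar>g (zs i)\<bar>" for i
  proof -
    have "real i * \<bar>g (zs i)\<bar> \<le> real (\<phi> i) * \<bar>g (zs i)\<bar>"
      using seq_suble[OF \<phi>, of i] by (intro mult_right_mono) auto
    also have "\<dots> < \<bar>f (zs i)\<bar>" using big[of "\<phi> i"] by (simp add: zs_def)
    finally show ?thesis .
  qed
  have expand: "zs i - x = (\<Sum>j<k. a j i *\<^sub>R us ! j)" for i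
    using res[of i] by (simp add: frame_residual_def zs_def k_def a_def)
  have ratio: "(\<lambda>i. a (Suc j) i / a j i) \<longlonglongrightarrow> 0" if "Suc j < k" for j
    unfolding a_def using frenet_coord_ratio[OF fz] that k_def by blast
  have pos: "\<forall>\<^sub>F i in sequentially. a j i > 0" if "j < k" for j
    unfolding a_def using frenet_coord_pos[OF fz] that k_def by blast
  have null: "a j \<longlonglongrightarrow> 0" for j
  proof -
    have "(\<lambda>i. (zs i - x) \<bullet> us ! j) \<longlonglongrightarrow> (x - x) \<bullet> us ! j" by (intro tendsto_intros lim)
    then show ?thesis by (simp add: a_def[abs_def])
  qed
  define c where "c j = \<alpha> \<bullet> us ! j" for j
  define d where "d j = \<beta> \<bullet> us ! j" for j
  have fsum: "f (zs i) = (\<Sum>j<k. c j * a j i)" for i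
    unfolding f_eq[OF zsT] expand by (simp add: inner_sum_right c_def mult.commute)
  have gsum: "g (zs i) = (\<Sum>j<k. d j * a j i)" for i
    unfolding g_eq[OF zsT] expand by (simp add: inner_sum_right d_def mult.commute)
  \<comment> \<open>The inequality at index 0 says that \<open>f (zs 0)\<close> is nonzero.\<close>
  have ex: "\<exists>j. j < k \<and> c j \<noteq> 0"
  proof (rule ccontr)
    assume "\<not> ?thesis"
    then have "f (zs 0) = 0" by (simp add: fsum)
    then show False using bigz[of 0] by simp
  qed
  txt \<open>The tangent is cut off at the first direction in which \<open>f\<close> grows.\<close>
  define r where "r = (LEAST j. j < k \<and> c j \<noteq> 0)"
  have r: "r < k" "c r \<noteq> 0" using LeastI_ex[OF ex] by (simp_all add: r_def)
  have c0: "c j = 0" if "j < r" for j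
    using not_less_Least[of j "\<lambda>j. j < k \<and> c j \<noteq> 0"] that r(1) by (auto simp: r_def[symmetric])
  \<comment> \<open>For \<open>j \<le> r\<close> all earlier coefficients of \<open>f\<close> and
    \<open>g\<close> vanish, so after division by \<open>a j\<close> the limits are
    \<open>c j\<close> and \<open>d j\<close>, and domination forces \<open>d j = 0\<close>.\<close>
  have d0: "d j = 0" if "j \<le> r" for j
    using that
  proof (induction j rule: less_induct)
    case (less j)
    have j: "j < k" using less.prems r by simp
    have "(\<lambda>i. f (zs i) / a j i) \<longlonglongrightarrow> c j"
      unfolding fsum using j less.prems c0
      by (intro leading_term[where k = k and a = a, OF ratio pos]) auto
    moreover have "(\<lambda>i. g (zs i) / a j i) \<longlonglongrightarrow> d j"
      unfolding gsum using j less
      by (intro leading_term[where k = k and a = a, OF ratio pos]) auto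
    moreover have "\<forall>\<^sub>F i in sequentially. real i * \<bar>g (zs i) / a j i\<bar> \<le> \<bar>f (zs i) / a j i\<bar>"
      using pos[OF j]
    proof eventually_elim
      case (elim i)
      then show ?case using bigz[of i] by (simp add: divide_right_mono less_imp_le)
    qed
    ultimately show ?case by (rule limit_zero_of_dominated)
  qed
  define V where "V m i = x + (\<Sum>j<m. a j i *\<^sub>R us ! j)" for m i
  have "\<forall>\<^sub>F i in sequentially. \<forall>m\<in>{..Suc r}. V m i \<in> T"
  proof (intro eventually_ball_finite ballI)
    fix m assume "m \<in> {..Suc r}"
    then have "m \<le> k" using r by simp
    moreover have "x + (\<Sum>j<k. a j i *\<^sub>R us ! j) \<in> T" for i
      using zsT[of i] by (simp flip: expand)
    ultimately show "\<forall>\<^sub>F i in sequentially. V m i \<in> T"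
      unfolding V_def using x
      by (intro partial_sums_in_polyhedron[where k = k and a = a, OF T _ ratio pos null]) auto
  qed simp
  moreover have "\<forall>\<^sub>F i in sequentially. \<forall>j\<in>{..r}. a j i > 0"
    using r by (intro eventually_ball_finite ballI pos) auto
  ultimately have "\<forall>\<^sub>F i in sequentially. (\<forall>m\<in>{..Suc r}. V m i \<in> T) \<and> (\<forall>j\<in>{..r}. a j i > 0)"
    by (rule eventually_conj)
  then obtain i0 where VT: "\<And>m. m \<le> Suc r \<Longrightarrow> V m i0 \<in> T" and ai: "\<And>j. j \<le> r \<Longrightarrow> a j i0 > 0"
    using eventually_happens'[OF trivial_limit_sequentially] by fastforce
  txt \<open>The edge lengths are the coordinates of one late term of the sequence: they decay fast
    enough for the whole simplex to stay inside \<open>T\<close>.\<close>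
  define lam where "lam j = a j i0" for j
  define vs where "vs = take (Suc r) us"
  have vs: "length vs = Suc r" using r by (simp add: vs_def k_def)
  have fv: "frame_vertex x lam vs m = V m i0" if "m \<le> Suc r" for m
    unfolding frame_vertex_def V_def lam_def vs_def using that by simp
  have tan: "tangent X x vs"
    unfolding tangent_def
  proof (intro conjI exI[of _ zs] allI)
    show "orthonormal_list vs" unfolding vs_def by (rule orthonormal_list_take[OF on])
    show "frenet_frame zs x vs"
      unfolding vs_def using r by (intro frenet_frame_take[OF fz]) (auto simp: k_def)
  qed (use vs zsT lim in auto)
  define C where "C = convex hull {frame_vertex x lam vs m | m. m \<le> length vs}"
  define C' where "C' = convex hull {frame_vertex x lam vs m | m. m < length vs}"
  have "C' \<subseteq> C" unfolding C_def C'_def by (intro hull_mono) auto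
  have "C \<subseteq> T"
    unfolding C_def using VT fv vs polyhedron_imp_convex[OF T] by (intro hull_minimal) auto
  have inner_V: "w \<bullet> V m i0 = w \<bullet> x + (\<Sum>j<m. (w \<bullet> us ! j) * lam j)" for w m
    by (simp add: V_def inner_add_right inner_sum_right lam_def mult.commute)
  have "C \<subseteq> {y. \<beta> \<bullet> y = \<beta> \<bullet> x}"
    unfolding C_def
  proof (rule hull_minimal)
    show "{frame_vertex x lam vs m | m. m \<le> length vs} \<subseteq> {y. \<beta> \<bullet> y = \<beta> \<bullet> x}"
      using d0 by (auto simp: fv vs inner_V d_def intro!: sum.neutral)
  qed (rule convex_hyperplane)
  \<comment> \<open>On \<open>C \<inter> X\<close> the function \<open>g\<close> vanishes, hence so
    does \<open>f\<close>. The slope \<open>\<alpha>\<close> of \<open>f\<close> is constant on the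
    vertices of \<open>C'\<close> and takes another value at the last vertex, because
    \<open>c r \<noteq> 0\<close>; so \<open>y\<close> lies in \<open>C'\<close>.\<close>
  have "y \<in> C'" if "y \<in> C" "y \<in> X" for y
  proof -
    have yT: "y \<in> T \<inter> X" using that \<open>C \<subseteq> T\<close> by blast
    have "g y = 0" using g_eq[OF yT] \<open>C \<subseteq> {y. \<beta> \<bullet> y = \<beta> \<bullet> x}\<close> that by (auto simp: inner_diff_right)
    then have "f y = 0" using zero that by blast
    then have y: "\<alpha> \<bullet> y = \<alpha> \<bullet> x" using f_eq[OF yT] by (simp add: inner_diff_right)
    have "{frame_vertex x lam vs m | m. m \<le> length vs} =
        insert (V (Suc r) i0) {frame_vertex x lam vs m | m. m < length vs}"
      using vs fv[of "Suc r", symmetric] by (auto simp: le_Suc_eq less_Suc_eq_le)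
    then have "y \<in> convex hull (insert (V (Suc r) i0) {frame_vertex x lam vs m | m. m < length vs})"
      using that(1) by (simp add: C_def)
    then show ?thesis
      unfolding C'_def
    proof (rule convex_hull_insert_hyperplane)
      show "{frame_vertex x lam vs m | m. m < length vs} \<noteq> {}" using vs by auto
      show "\<alpha> \<bullet> z = \<alpha> \<bullet> x" if "z \<in> {frame_vertex x lam vs m | m. m < length vs}" for z
        using that c0 by (auto simp: fv vs inner_V c_def intro!: sum.neutral)
      have "(\<Sum>j<r. (\<alpha> \<bullet> us ! j) * lam j) = 0" using c0 by (intro sum.neutral) (simp add: c_def)
      then show "\<alpha> \<bullet> V (Suc r) i0 \<noteq> \<alpha> \<bullet> x"
        using r(2) ai[of r] by (simp add: inner_V c_def lam_def)
    qed (rule y)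
  qed
  then have "C \<inter> X = C' \<inter> X" using \<open>C' \<subseteq> C\<close> by blast
  moreover have "\<forall>j<length vs. lam j > 0" using ai vs by (simp add: lam_def)
  ultimately have "outgoing_tangent X x vs"
    unfolding outgoing_tangent_def Let_def C_def C'_def using tan by blast
  then show ?thesis using x by blast
qed

theorem theorem5p1:
  fixes X :: "'a::euclidean_space set"
  assumes "X \<noteq> {}" and "compact X"
  shows "(\<exists>x\<in>X. \<exists>us. outgoing_tangent X x us) \<longleftrightarrow> \<not> strongly_semisimple X"
  unfolding not_strongly_semisimple_iff[OF assms(2)]
proof
  assume "\<exists>x\<in>X. \<exists>us. outgoing_tangent X x us"
  then show "\<exists>f\<in>RX X. \<exists>g\<in>RX X. (\<forall>y\<in>X. g y = 0 \<longrightarrow> f y = 0) \<and>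
      (\<forall>m::nat. \<exists>y\<in>X. \<bar>f y\<bar> > real m * \<bar>g y\<bar>)"
    using outgoing_tangent_imp_unbounded_ratio[OF compact_imp_bounded[OF assms(2)]] by metis
next
  assume "\<exists>f\<in>RX X. \<exists>g\<in>RX X. (\<forall>y\<in>X. g y = 0 \<longrightarrow> f y = 0) \<and>
      (\<forall>m::nat. \<exists>y\<in>X. \<bar>f y\<bar> > real m * \<bar>g y\<bar>)"
  then obtain f g where fg: "f \<in> RX X" "g \<in> RX X" and "\<forall>y\<in>X. g y = 0 \<longrightarrow> f y = 0"
      "\<forall>m::nat. \<exists>y\<in>X. \<bar>f y\<bar> > real m * \<bar>g y\<bar>"
    by (elim bexE conjE) (rule that)
  then show "\<exists>x\<in>X. \<exists>us. outgoing_tangent X x us"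
    by (intro unbounded_ratio_imp_outgoing_tangent[OF assms(2) fg]) simp_all
qed

end
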